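(* Let $I=[0,1]$, let $f:I\to I$ be a continuous densely chaotic map and let $\overline f:\mathcal K(I)\to\mathcal K(I)$ be the map induced by $f$. Then $\overline f$ is densely chaotic.
   Context: For a compact metric space $(X,d)$, $\mathcal K(X)$ denotes the set of all non-empty compact subsets of $X$ with the Hausdorff metric $d_H$ (a compact metric space). A continuous map $f:X\to X$ induces the continuous map $\overline f:\mathcal K(X)\to\mathcal K(X)$, $\overline f(K)=f(K)=\{f(x): x\in K\}$. For a continuous map $g:Y\to Y$ of a compact metric space $(Y,\rho)$, let $C(g)$ be the set of Li-Yorke pairs, i.e. pairs $(x,y)\in Y^2$ with $\liminf_{n\to\infty}\rho(g^n(x),g^n(y))=0$ and $\limsup_{n\to\infty}\rho(g^n(x),g^n(y))>0$. The map $g$ is densely chaotic if $C(g)$ is dense in $Y^2$. For $\overline f$ this is applied with $Y=\mathcal K(X)$, $\rho=d_H$. *)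

theory Defs
  imports "HOL-Analysis.Analysis"
begin

context Metric_space
begin

definition hyperspace :: "'a set set" where
  "hyperspace = {K. K \<noteq> {} \<and> compactin mtopology K}"

lemma hyperspace_subset: "K \<in> hyperspace \<Longrightarrow> K \<subseteq> M"
  using compactin_subset_topspace[of mtopology K] by (simp add: hyperspace_def)

text \<open>Off the hyperspace the real-valued suprema and infima carry no meaning; the value 0 there
  serves only to satisfy the locale, which demands nonnegativity and symmetry everywhere.\<close>

definition hausdorff_dist :: "'a set \<Rightarrow> 'a set \<Rightarrow> real" where
  "hausdorff_dist A B =
     (if A \<in> hyperspace \<and> B \<in> hyperspace
      then max (SUP x\<in>A. INF y\<in>B. d x y) (SUP y\<in>B. INF x\<in>A. d x y)
      else 0)"

text \<open>Lower and upper limits are taken in the extended reals, where they always exist.\<close>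

definition li_yorke_pairs :: "('a \<Rightarrow> 'a) \<Rightarrow> ('a \<times> 'a) set" where
  "li_yorke_pairs g = {(x, y). x \<in> M \<and> y \<in> M \<and>
     liminf (\<lambda>n. ereal (d ((g ^^ n) x) ((g ^^ n) y))) = 0 \<and>
     limsup (\<lambda>n. ereal (d ((g ^^ n) x) ((g ^^ n) y))) > 0}"

definition densely_chaotic :: "('a \<Rightarrow> 'a) \<Rightarrow> bool" where
  "densely_chaotic g \<longleftrightarrow>
     (prod_topology mtopology mtopology) closure_of (li_yorke_pairs g) = M \<times> M"

lemma bdd_below_dist: "bdd_below (d x ` B)"
  by (rule bdd_belowI[of _ 0]) auto

lemma INF_dist_le_excess:
  assumes "A \<in> hyperspace" "B \<in> hyperspace" "x \<in> A"
  shows "(INF y\<in>B. d x y) \<le> (SUP x\<in>A. INF y\<in>B. d x y)"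
proof (rule cSUP_upper[OF assms(3)])
  obtain b where b: "b \<in> B" using assms by (auto simp: hyperspace_def)
  have sub: "A \<subseteq> M" "B \<subseteq> M"
    using assms by (auto dest: hyperspace_subset)
  have "mbounded A" using assms by (auto simp: hyperspace_def intro: compactin_imp_mbounded)
  with b sub obtain r where r: "\<And>a. a \<in> A \<Longrightarrow> d a b \<le> r"
    by (metis mbounded_alt_pos commute mbounded_insert insert_iff subsetD)
  have "(INF y\<in>B. d a y) \<le> r" if "a \<in> A" for a
    by (rule order_trans[OF cINF_lower[OF bdd_below_dist b] r[OF that]])
  then show "bdd_above ((\<lambda>x. INF y\<in>B. d x y) ` A)" by (auto intro!: bdd_aboveI)
qed

lemma excess_nearby:
  assumes "A \<in> hyperspace" "B \<in> hyperspace" "x \<in> A" "(SUP x\<in>A. INF y\<in>B. d x y) < r"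
  shows "\<exists>y\<in>B. d x y < r"
proof -
  have "(INF y\<in>B. d x y) < r" "B \<noteq> {}"
    using INF_dist_le_excess[OF assms(1-3)] assms by (auto simp: hyperspace_def)
  then show ?thesis using cINF_less_iff[OF _ bdd_below_dist] by blast
qed

lemma excess_triangle:
  assumes A: "A \<in> hyperspace" and B: "B \<in> hyperspace" and C: "C \<in> hyperspace"
  shows "(SUP x\<in>A. INF z\<in>C. d x z)
    \<le> (SUP x\<in>A. INF y\<in>B. d x y) + (SUP y\<in>B. INF z\<in>C. d y z)" (is "_ \<le> ?p + ?q")
proof (rule cSUP_least)
  show "A \<noteq> {}" using A by (auto simp: hyperspace_def)
  fix x assume x: "x \<in> A"
  have sub: "A \<subseteq> M" "B \<subseteq> M" "C \<subseteq> M"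
    using assms by (auto dest: hyperspace_subset)
  show "(INF z\<in>C. d x z) \<le> ?p + ?q"
  proof (rule field_le_epsilon)
    fix e :: real assume "e > 0"
    then obtain y where y: "y \<in> B" "d x y < ?p + e/2"
      using excess_nearby[OF A B x, of "?p + e/2"] by auto
    then obtain z where z: "z \<in> C" "d y z < ?q + e/2"
      using excess_nearby[OF B C y(1), of "?q + e/2"] \<open>e > 0\<close> by auto
    have "(INF z\<in>C. d x z) \<le> d x z" by (rule cINF_lower[OF bdd_below_dist z(1)])
    also have "\<dots> \<le> d x y + d y z" using x y z sub by (intro triangle) auto
    finally show "(INF z\<in>C. d x z) \<le> ?p + ?q + e" using y z by simp
  qed
qed

lemma excess_nonneg:
  assumes "A \<in> hyperspace" "B \<in> hyperspace"
  shows "0 \<le> (SUP x\<in>A. INF y\<in>B. d x y)"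
proof -
  obtain x where x: "x \<in> A" using assms by (auto simp: hyperspace_def)
  have "0 \<le> (INF y\<in>B. d x y)" using assms by (intro cINF_greatest) (auto simp: hyperspace_def)
  then show ?thesis using INF_dist_le_excess[OF assms x] by simp
qed

lemma excess_zero:
  assumes A: "A \<in> hyperspace" and B: "B \<in> hyperspace"
    and "(SUP x\<in>A. INF y\<in>B. d x y) \<le> 0"
  shows "A \<subseteq> B"
proof
  fix x assume x: "x \<in> A"
  have "closedin mtopology B"
    using B Hausdorff_space_mtopology by (auto simp: hyperspace_def intro: compactin_imp_closedin)
  moreover have "x \<in> M" using x A by (auto dest: hyperspace_subset)
  moreover have "\<exists>y\<in>B. d x y < r" if "r > 0" for r
    using excess_nearby[OF A B x, of r] assms(3) that by auto
  moreover have "B \<subseteq> M" using B by (auto dest: hyperspace_subset)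
  ultimately have "x \<in> mtopology closure_of B"
    by (auto simp: metric_closure_of in_mball)
  with \<open>closedin mtopology B\<close> show "x \<in> B" by (simp add: closure_of_closedin)
qed

lemma excess_self:
  assumes "A \<in> hyperspace"
  shows "(SUP x\<in>A. INF y\<in>A. d x y) = 0"
proof -
  have sub: "A \<subseteq> M" using assms by (auto dest: hyperspace_subset)
  have "(SUP x\<in>A. INF y\<in>A. d x y) \<le> 0"
  proof (rule cSUP_least)
    show "A \<noteq> {}" using assms by (auto simp: hyperspace_def)
    show "(INF y\<in>A. d x y) \<le> 0" if "x \<in> A" for x
      using cINF_lower[OF bdd_below_dist that, of x] that sub by auto
  qed
  with excess_nonneg[OF assms assms] show ?thesis by simp
qed

lemma Metric_space_hyperspace: "Metric_space hyperspace hausdorff_dist"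
proof
  fix A B C
  have eq: "hausdorff_dist A B =
    max (SUP x\<in>A. INF y\<in>B. d x y) (SUP x\<in>B. INF y\<in>A. d x y)"
    if "A \<in> hyperspace" "B \<in> hyperspace" for A B
    using that by (simp add: hausdorff_dist_def commute)
  show "0 \<le> hausdorff_dist A B"
    using excess_nonneg[of A B] by (auto simp: hausdorff_dist_def le_max_iff_disj)
  show "hausdorff_dist A B = hausdorff_dist B A"
    using eq[of A B] eq[of B A] by (cases "A \<in> hyperspace \<and> B \<in> hyperspace")
      (auto simp: max.commute hausdorff_dist_def[of A B] hausdorff_dist_def[of B A])
  show "hausdorff_dist A B = 0 \<longleftrightarrow> A = B" if AB: "A \<in> hyperspace" "B \<in> hyperspace"
  proof
    assume "hausdorff_dist A B = 0"
    then have "(SUP x\<in>A. INF y\<in>B. d x y) \<le> 0" "(SUP x\<in>B. INF y\<in>A. d x y) \<le> 0"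
      unfolding eq[OF AB] by linarith+
    then show "A = B" using excess_zero AB by blast
  qed (use AB excess_self in \<open>simp add: eq\<close>)
  show "hausdorff_dist A C \<le> hausdorff_dist A B + hausdorff_dist B C"
    if "A \<in> hyperspace" "B \<in> hyperspace" "C \<in> hyperspace"
    using excess_triangle[of A B C] excess_triangle[of C B A] that
    unfolding eq[OF that(1,3)] eq[OF that(1,2)] eq[OF that(2,3)] by linarith
qed

end

lemma hyperspace_dist_eq:
  fixes X :: "'a::metric_space set"
  shows "Metric_space.hyperspace X dist = {K. K \<noteq> {} \<and> compact K \<and> K \<subseteq> X}"
proof -
  interpret Submetric UNIV dist X by unfold_locales auto
  show ?thesis
    using sub.hyperspace_def by (auto simp: mtopology_submetric compactin_subtopology)
qed

end

theory Submission
  imports Defs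
begin

text \<open>
  By dense chaos any two periodic nondegenerate intervals meet, hence all of them share a fixed
  point c of f, the center. The orbit of every nondegenerate interval J has two intersecting
  members, so a tail of it, sampled at a fixed period, is dense in a periodic interval. As the
  center lies in that interval, an argument on the line (a sampled orbit that avoids c stays on one
  side of it) shows that the distance from c to the n-th image of J tends to 0. Approximate two given compact sets by
  finite families of small intervals. If each of these intervals has a point asymptotic to c, choose
  such points and add the two points of a Li-Yorke pair, one to each set. Otherwise some interval
  has a subinterval all of whose subintervals leave a fixed neighbourhood of c infinitely often;
  nested intervals then yield points, one in each interval, that are simultaneously close to c
  infinitely often, while infinitely often exactly one of them is far from c.
\<close>

section \<open>Li-Yorke pairs, dense chaos and the Hausdorff metric in elementary terms\<close>

lemma liminf_ereal_eq_0_iff: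
  fixes X :: "nat \<Rightarrow> real"
  assumes "\<And>n. 0 \<le> X n"
  shows "liminf (\<lambda>n. ereal (X n)) = 0 \<longleftrightarrow> (\<forall>e>0. \<exists>\<^sub>F n in sequentially. X n < e)"
proof
  assume L: "liminf (\<lambda>n. ereal (X n)) = 0"
  show "\<forall>e>0. \<exists>\<^sub>F n in sequentially. X n < e"
  proof (intro allI impI, rule ccontr)
    fix e :: real assume "e > 0" and "\<not> (\<exists>\<^sub>F n in sequentially. X n < e)"
    then have "\<forall>\<^sub>F n in sequentially. ereal e \<le> ereal (X n)"
      by (simp add: not_frequently not_less)
    then have "ereal e \<le> liminf (\<lambda>n. ereal (X n))" by (rule Liminf_bounded)
    with L \<open>e > 0\<close> show False by simp
  qed
next
  assume F: "\<forall>e>0. \<exists>\<^sub>F n in sequentially. X n < e"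
  have "0 \<le> liminf (\<lambda>n. ereal (X n))" using assms by (intro Liminf_bounded) auto
  moreover have "\<not> 0 < liminf (\<lambda>n. ereal (X n))"
  proof
    assume "0 < liminf (\<lambda>n. ereal (X n))"
    then obtain e where e: "0 < ereal e" "ereal e < liminf (\<lambda>n. ereal (X n))"
      using ereal_dense2 by blast
    from less_LiminfD[OF e(2)] have "\<forall>\<^sub>F n in sequentially. \<not> X n < e"
      by (auto elim: eventually_mono)
    with F e(1) show False by (auto simp: frequently_def)
  qed
  ultimately show "liminf (\<lambda>n. ereal (X n)) = 0" by auto
qed

lemma limsup_ereal_pos_iff:
  fixes X :: "nat \<Rightarrow> real"
  shows "limsup (\<lambda>n. ereal (X n)) > 0 \<longleftrightarrow> (\<exists>e>0. \<exists>\<^sub>F n in sequentially. e < X n)"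
proof
  assume "limsup (\<lambda>n. ereal (X n)) > 0"
  then obtain e where e: "0 < ereal e" "ereal e < limsup (\<lambda>n. ereal (X n))"
    using ereal_dense2 by blast
  have "\<exists>\<^sub>F n in sequentially. e < X n"
  proof (rule ccontr)
    assume "\<not> (\<exists>\<^sub>F n in sequentially. e < X n)"
    then have "\<forall>\<^sub>F n in sequentially. ereal (X n) \<le> ereal e"
      by (simp add: not_frequently not_less)
    then have "limsup (\<lambda>n. ereal (X n)) \<le> ereal e" by (rule Limsup_bounded)
    with e(2) show False by simp
  qed
  with e(1) show "\<exists>e>0. \<exists>\<^sub>F n in sequentially. e < X n" by auto
next
  assume "\<exists>e>0. \<exists>\<^sub>F n in sequentially. e < X n"
  then obtain e where e: "e > 0" "\<exists>\<^sub>F n in sequentially. e < X n" by auto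
  show "limsup (\<lambda>n. ereal (X n)) > 0"
  proof (rule ccontr)
    assume "\<not> limsup (\<lambda>n. ereal (X n)) > 0"
    then have "limsup (\<lambda>n. ereal (X n)) \<le> 0" by simp
    also have "0 < ereal e" using e(1) by simp
    finally have "limsup (\<lambda>n. ereal (X n)) < ereal e" .
    from Limsup_lessD[OF this] have "\<forall>\<^sub>F n in sequentially. \<not> e < X n"
      by (auto elim: eventually_mono)
    with e(2) show False by (auto simp: frequently_def)
  qed
qed

context Metric_space
begin

lemma li_yorke_pairs_iff:
  "(x, y) \<in> li_yorke_pairs g \<longleftrightarrow> x \<in> M \<and> y \<in> M \<and>
     (\<forall>e>0. \<exists>\<^sub>F n in sequentially. d ((g ^^ n) x) ((g ^^ n) y) < e) \<and>
     (\<exists>e>0. \<exists>\<^sub>F n in sequentially. e < d ((g ^^ n) x) ((g ^^ n) y))"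
  by (simp add: li_yorke_pairs_def liminf_ereal_eq_0_iff limsup_ereal_pos_iff)

text \<open>Products of balls form a base of the product topology. The criterion is read from left
  to right for \<open>f\<close> on the interval and from right to left for the induced map on the
  hyperspace.\<close>

lemma densely_chaotic_iff:
  "densely_chaotic g \<longleftrightarrow>
     (\<forall>x\<in>M. \<forall>y\<in>M. \<forall>r>0. \<exists>u v. (u, v) \<in> li_yorke_pairs g \<and> d x u < r \<and> d y v < r)"
proof
  assume D: "densely_chaotic g"
  show "\<forall>x\<in>M. \<forall>y\<in>M. \<forall>r>0. \<exists>u v. (u, v) \<in> li_yorke_pairs g \<and> d x u < r \<and> d y v < r"
  proof (intro ballI allI impI)
    fix x y and r :: real assume xy: "x \<in> M" "y \<in> M" and "r > 0"
    have cl: "(x, y) \<in> prod_topology mtopology mtopology closure_of li_yorke_pairs g"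
      using D xy by (simp add: densely_chaotic_def)
    have "openin (prod_topology mtopology mtopology) (mball x r \<times> mball y r)"
      by (simp add: openin_prod_Times_iff)
    moreover have "(x, y) \<in> mball x r \<times> mball y r" using xy \<open>r > 0\<close> by simp
    ultimately obtain p where "p \<in> li_yorke_pairs g" "p \<in> mball x r \<times> mball y r"
      using cl[unfolded in_closure_of, THEN conjunct2, rule_format, of "mball x r \<times> mball y r"]
      by blast
    then show "\<exists>u v. (u, v) \<in> li_yorke_pairs g \<and> d x u < r \<and> d y v < r"
      by (cases p) auto
  qed
next
  assume R: "\<forall>x\<in>M. \<forall>y\<in>M. \<forall>r>0. \<exists>u v. (u, v) \<in> li_yorke_pairs g \<and> d x u < r \<and> d y v < r"
  have "(x, y) \<in> prod_topology mtopology mtopology closure_of li_yorke_pairs g"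
    if xy: "x \<in> M" "y \<in> M" for x y
    unfolding in_closure_of
  proof (intro conjI allI impI)
    show "(x, y) \<in> topspace (prod_topology mtopology mtopology)" using xy by simp
    fix T assume T: "(x, y) \<in> T \<and> openin (prod_topology mtopology mtopology) T"
    obtain U V where UV: "openin mtopology U" "openin mtopology V" "x \<in> U" "y \<in> V"
      "U \<times> V \<subseteq> T"
      using T[THEN conjunct2, unfolded openin_prod_topology_alt, rule_format, OF T[THEN conjunct1]]
      by blast
    obtain r s where rs: "r > 0" "mball x r \<subseteq> U" "s > 0" "mball y s \<subseteq> V"
      using UV(1-4) unfolding openin_mtopology by meson
    obtain u v where uv: "(u, v) \<in> li_yorke_pairs g" "d x u < min r s" "d y v < min r s"
      using R[rule_format, OF xy, of "min r s"] rs by auto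
    then have "u \<in> mball x r" "v \<in> mball y s" using xy by (auto simp: li_yorke_pairs_def)
    with rs UV uv show "\<exists>z. z \<in> li_yorke_pairs g \<and> z \<in> T" by blast
  qed
  then show "densely_chaotic g"
    unfolding densely_chaotic_def
    using closure_of_subset_topspace[of "prod_topology mtopology mtopology" "li_yorke_pairs g"]
    by auto
qed

lemma hausdorff_dist_le:
  assumes AB: "A \<in> hyperspace" "B \<in> hyperspace"
    and "\<And>x. x \<in> A \<Longrightarrow> \<exists>y\<in>B. d x y \<le> r" "\<And>y. y \<in> B \<Longrightarrow> \<exists>x\<in>A. d x y \<le> r"
  shows "hausdorff_dist A B \<le> r"
proof -
  have ne: "A \<noteq> {}" "B \<noteq> {}" using AB by (auto simp: hyperspace_def)
  have bdd: "bdd_below ((\<lambda>x. d x y) ` A)" for y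
    by (rule bdd_belowI[of _ 0]) auto
  have "(SUP x\<in>A. INF y\<in>B. d x y) \<le> r"
    using assms(3) by (intro cSUP_least ne) (meson cINF_lower2 bdd_below_dist)
  moreover have "(SUP y\<in>B. INF x\<in>A. d x y) \<le> r"
  proof (intro cSUP_least ne)
    fix y assume "y \<in> B"
    then obtain x where "x \<in> A" "d x y \<le> r" using assms(4) by blast
    then show "(INF x\<in>A. d x y) \<le> r" using bdd by (meson cINF_lower2)
  qed
  ultimately show ?thesis using AB by (simp add: hausdorff_dist_def)
qed

lemma hausdorff_dist_less_imp:
  assumes AB: "A \<in> hyperspace" "B \<in> hyperspace" and less: "hausdorff_dist A B < r"
  shows "x \<in> A \<Longrightarrow> \<exists>y\<in>B. d x y < r" "y \<in> B \<Longrightarrow> \<exists>x\<in>A. d x y < r"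
  using less excess_nearby[OF AB, of x r] excess_nearby[OF AB(2,1), of y r] AB
  by (simp_all add: hausdorff_dist_def commute)

end

section \<open>Iterated images of an interval that accumulate at a fixed point\<close>

lemma connected_UN_consecutive:
  fixes J :: "nat \<Rightarrow> 'a::topological_space set"
  assumes "\<And>i. connected (J i)" "\<And>i. J i \<inter> J (Suc i) \<noteq> {}"
  shows "connected (\<Union>i. J i)"
proof -
  have 1: "connected (\<Union>i\<le>n. J i)" for n
  proof (induction n)
    case (Suc n)
    have "(\<Union>i\<le>n. J i) \<inter> J (Suc n) \<noteq> {}" using assms(2)[of n] by blast
    with Suc assms(1) have "connected ((\<Union>i\<le>n. J i) \<union> J (Suc n))" by (intro connected_Un)
    then show ?case by (simp add: atMost_Suc Un_commute)
  qed (simp add: assms)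
  obtain p where p: "p \<in> J 0" using assms(2)[of 0] by blast
  have "connected (\<Union> (range (\<lambda>n. \<Union>i\<le>n. J i)))"
    using 1 p by (intro connected_Union) auto
  moreover have "\<Union> (range (\<lambda>n. \<Union>i\<le>n. J i)) = (\<Union>i. J i)" by auto
  ultimately show ?thesis by simp
qed

lemma funpow_image_subset: "g ` S \<subseteq> S \<Longrightarrow> (g ^^ i) ` S \<subseteq> S"
  by (induction i) auto

lemma continuous_on_funpow_self:
  assumes "continuous_on S g" "g ` S \<subseteq> S"
  shows "continuous_on S (g ^^ i)"
proof (induction i)
  case (Suc i)
  have "continuous_on S (g \<circ> (g ^^ i))"
    using Suc funpow_image_subset[OF assms(2)] assms(1)
    by (intro continuous_on_compose) (auto intro: continuous_on_subset)
  then show ?case by simp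
qed (simp add: id_def)

text \<open>\<open>g ^^ i\<close> carries a common point of \<open>J\<close> and its image to a
  common point of two consecutive iterated images, so the iterated images form a chain.\<close>

lemma connected_UN_funpow_image:
  assumes g: "continuous_on S g" "g ` S \<subseteq> S"
    and J: "J \<subseteq> S" "connected J" "J \<inter> g ` J \<noteq> {}"
  shows "connected (\<Union>i. (g ^^ i) ` J)"
proof (rule connected_UN_consecutive)
  fix i
  show "connected ((g ^^ i) ` J)"
    using continuous_on_funpow_self[OF g] J
    by (intro connected_continuous_image) (auto intro: continuous_on_subset)
  obtain p q where "p \<in> J" "q \<in> J" "p = g q" using J(3) by auto
  then have "(g ^^ i) p \<in> (g ^^ i) ` J \<inter> (g ^^ Suc i) ` J"
    by (auto simp: funpow_swap1)
  then show "(g ^^ i) ` J \<inter> (g ^^ Suc i) ` J \<noteq> {}" by blast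
qed

text \<open>The union \<open>U\<close> of the iterated images is an interval with \<open>c\<close>
  as its excluded left end. Just to the right of \<open>c\<close>, either some point is fixed or
  moves left, and then one orbit stays close to \<open>c\<close>; or all points move right, and then
  the orbit of \<open>J\<close> stays away from \<open>c\<close>, which contradicts the closure
  assumption.\<close>

lemma iterates_approach_fixpoint_right:
  fixes g :: "real \<Rightarrow> real"
  assumes S: "compact S" "continuous_on S g" "g ` S \<subseteq> S"
    and J: "J \<subseteq> S" "compact J" "connected J" "J \<inter> g ` J \<noteq> {}"
    and c: "g c = c" "c \<in> closure (\<Union>i. (g ^^ i) ` J)"
    and right: "\<And>x. x \<in> (\<Union>i. (g ^^ i) ` J) \<Longrightarrow> c < x"
    and "e > 0"
  shows "\<forall>\<^sub>F i in sequentially. \<exists>x\<in>J. \<bar>(g ^^ i) x - c\<bar> < e"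
proof -
  define U where "U = (\<Union>i. (g ^^ i) ` J)"
  define L where "L = closure U"
  have itS: "(g ^^ i) ` S \<subseteq> S" for i
    using S(3) by (rule funpow_image_subset)
  have US: "U \<subseteq> S" using J(1) itS by (force simp: U_def)
  have LS: "L \<subseteq> S" unfolding L_def using US S(1) by (simp add: closure_minimal compact_imp_closed)
  have gU: "g x \<in> U" if x: "x \<in> U" for x
  proof -
    obtain i y where "y \<in> J" "x = (g ^^ i) y" using x by (auto simp: U_def)
    then have "g x = (g ^^ Suc i) y" by simp
    with \<open>y \<in> J\<close> show ?thesis unfolding U_def by blast
  qed
  have JU: "J \<subseteq> U" unfolding U_def by (force intro: exI[of _ 0])
  have UJ: "U \<subseteq> J \<union> g ` U"
  proof
    fix x assume "x \<in> U"
    then obtain i y where y: "y \<in> J" "x = (g ^^ i) y" by (auto simp: U_def)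
    show "x \<in> J \<union> g ` U"
    proof (cases i)
      case (Suc j)
      have "(g ^^ j) y \<in> U" using y by (auto simp: U_def)
      with y Suc show ?thesis by auto
    qed (use y in auto)
  qed
  have conU: "connected U"
    unfolding U_def by (rule connected_UN_funpow_image[OF S(2,3) J(1,3,4)])
  have ivl: "x \<in> U" if "y \<in> U" "z \<in> U" "y \<le> x" "x \<le> z" for x y z
    using conU that connectedD_interval by metis
  have cl: "\<exists>y\<in>U. \<bar>y - x\<bar> < r" if "x \<in> L" "r > 0" for x r
    using that by (auto simp: L_def closure_approachable dist_real_def)
  have Uc: "c < x" if "x \<in> U" for x using right that by (simp add: U_def)
  have cL: "c \<in> L" using c by (simp add: L_def U_def)
  have Lc: "c \<le> x" if "x \<in> L" for x
    using cl[OF that, of "c - x"] Uc by force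
  \<comment> \<open>One orbit is enough: \<open>z\<close> is reached from some \<open>y\<close> in
    \<open>J\<close> after \<open>k\<close> steps, and this single \<open>y\<close> is a witness for
    all times from \<open>k\<close> on.\<close>
  have goal: ?thesis if "z \<in> U" "\<And>i. (g ^^ i) z < c + e" for z
  proof -
    obtain k y where y: "y \<in> J" "z = (g ^^ k) y" using \<open>z \<in> U\<close> by (auto simp: U_def)
    have "\<exists>x\<in>J. \<bar>(g ^^ i) x - c\<bar> < e" if "i \<ge> k" for i
    proof (rule bexI[OF _ y(1)])
      have "(g ^^ i) y = (g ^^ (i - k)) z" using y that funpow_add[of "i - k" k g] by simp
      moreover have "(g ^^ i) y \<in> U" using y by (auto simp: U_def)
      ultimately show "\<bar>(g ^^ i) y - c\<bar> < e"
        using Uc[of "(g ^^ i) y"] \<open>\<And>i. (g ^^ i) z < c + e\<close>[of "i - k"] by linarith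
    qed
    then show ?thesis by (auto simp: eventually_sequentially)
  qed
  show ?thesis
  proof (cases "\<exists>z\<in>U. z < c + e \<and> g z = z")
    case True
    then obtain z where z: "z \<in> U" "z < c + e" "g z = z" by blast
    have "(g ^^ i) z = z" for i using z(3) by (induction i) auto
    with z goal show ?thesis by simp
  next
    case nofix: False
    show ?thesis
    proof (cases "\<exists>z\<in>U. z < c + e \<and> g z < z")
      case True
      then obtain z where z: "z \<in> U" "z < c + e" "g z < z" by blast
      \<comment> \<open>Without fixed points in this range, \<open>g x - x\<close> keeps its sign
        between \<open>x\<close> and \<open>z\<close> by the intermediate value theorem; so the
        orbit of \<open>z\<close> decreases and stays below \<open>c + e\<close>.\<close>
      have down: "g x < x" if x: "x \<in> U" "x < c + e" for x
      proof (rule ccontr)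
        assume "\<not> g x < x"
        with nofix x have gx: "g x - x > 0" by force
        let ?K = "{min x z..max x z}"
        have K: "?K \<subseteq> U" 
        proof
          fix w assume "w \<in> ?K"
          then show "w \<in> U"
            using ivl[OF x(1) z(1), of w] ivl[OF z(1) x(1), of w] by (cases "x \<le> z") auto
        qed
        have cK: "continuous_on ?K (\<lambda>x. g x - x)"
          using K US S(2) by (intro continuous_intros) (blast intro: continuous_on_subset)
        have "connected ((\<lambda>x. g x - x) ` ?K)" by (rule connected_continuous_image[OF cK]) simp
        moreover have "g z - z \<in> (\<lambda>x. g x - x) ` ?K" "g x - x \<in> (\<lambda>x. g x - x) ` ?K" by auto
        ultimately have "0 \<in> (\<lambda>x. g x - x) ` ?K"
          using gx z(3) connectedD_interval[of _ "g z - z" "g x - x" 0] by simp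
        then obtain w where "w \<in> ?K" "g w = w" by auto
        then show False using nofix K x z by force
      qed
      have "(g ^^ i) z \<in> U \<and> (g ^^ i) z < c + e" for i
      proof (induction i)
        case (Suc i)
        then show ?case using gU down[of "(g ^^ i) z"] by auto
      qed (use z in auto)
      with z goal show ?thesis by blast
    next
      case False
      \<comment> \<open>In this case all points of \<open>U\<close> below \<open>c + e\<close> move
        right. The iterates of \<open>J\<close> then have a lower bound \<open>h > c\<close>,
        contrary to \<open>c\<close> being in the closure of \<open>U\<close>.\<close>
      with nofix have up: "g x > x" if "x \<in> U" "x < c + e" for x
        using that by force
      obtain u where u: "u \<in> U" "u < c + e" using cl[OF cL \<open>e > 0\<close>] by force
      \<comment> \<open>Strictness at the points of \<open>L\<close> outside \<open>U\<close>
        matters for the minimum \<open>b\<close> taken below: such an \<open>x\<close> with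
        \<open>x \<ge> u\<close> can only be the right end missing from \<open>U\<close>, and it
        turns out to be fixed by \<open>g\<close>.\<close>
      have gL: "g x > c" if x: "x \<in> L" "x \<ge> u" for x
      proof (cases "x \<in> U")
        case True
        then show ?thesis using gU Uc by blast
      next
        case xU: False
        have "u < x" using x u xU by (cases "u = x") auto
        have top: "y \<le> x" if "y \<in> U" for y
          using ivl[OF u(1) that x(2)] xU by force
        \<comment> \<open>\<open>U\<close> lies in the union of \<open>J\<close> and the image of
          \<open>L\<close>. This set is closed, so it also contains \<open>x\<close>; as
          \<open>x\<close> is not in \<open>J\<close>, it has a preimage in
          \<open>L\<close>.\<close>
        have "closed (J \<union> g ` L)"
        proof (intro closed_Un compact_imp_closed J)
          have "compact L" using compact_Int_closed[OF S(1), of L] LS by (simp add: L_def Int_absorb1)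
          then show "compact (g ` L)"
            using LS S(2) by (intro compact_continuous_image) (auto intro: continuous_on_subset)
        qed
        moreover have "U \<subseteq> J \<union> g ` L" using UJ closure_subset[of U] unfolding L_def by blast
        ultimately have "L \<subseteq> J \<union> g ` L" unfolding L_def by (intro closure_minimal)
        with x JU xU obtain y where y: "y \<in> L" "x = g y" by auto
        \<comment> \<open>Any other preimage lies strictly between \<open>c\<close> and
          \<open>x\<close>, hence in the interval \<open>U\<close>, whose invariance would put
          \<open>x\<close> in \<open>U\<close>.\<close>
        have "y = x"
        proof (rule ccontr)
          assume "y \<noteq> x"
          have "y \<le> x"
            using cl[OF y(1), of "y - x"] top by force
          with \<open>y \<noteq> x\<close> have "y < x" by simp
          have "y \<noteq> c" using y c \<open>u < x\<close> Uc[OF u(1)] by auto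
          with Lc[OF y(1)] have "c < y" by simp
          obtain s where "s \<in> U" "s < y" using cl[OF cL, of "y - c"] \<open>c < y\<close> by force
          moreover obtain t where "t \<in> U" "y < t" using cl[OF x(1), of "x - y"] \<open>y < x\<close> by force
          ultimately have "y \<in> U" using ivl[of s t y] by simp
          then show False using gU y xU by blast
        qed
        then show ?thesis using y \<open>u < x\<close> Uc[OF u(1)] by auto
      qed
      have "compact (L \<inter> {u..})"
        using compact_Int_closed[OF S(1), of "L \<inter> {u..}"] LS
        by (simp add: L_def Int_absorb1 closed_Int inf.coboundedI1)
      then have "compact (g ` (L \<inter> {u..}))"
        using LS S(2) by (intro compact_continuous_image) (auto intro: continuous_on_subset)
      moreover have "g ` (L \<inter> {u..}) \<noteq> {}" using u closure_subset[of U] by (auto simp: L_def)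
      ultimately obtain b where b: "b \<in> g ` (L \<inter> {u..})" "\<And>y. y \<in> g ` (L \<inter> {u..}) \<Longrightarrow> b \<le> y"
        using compact_attains_inf by metis
      have "c < b" using b(1) gL by auto
      have "J \<noteq> {}" using J by auto
      then obtain m where m: "m \<in> J" "\<And>x. x \<in> J \<Longrightarrow> m \<le> x"
        using compact_attains_inf[OF J(2)] by metis
      \<comment> \<open>The bound holds on \<open>J\<close> because of \<open>m\<close> and survives
        each step: points from \<open>u\<close> on have images at or above \<open>b\<close>, and
        points below \<open>u\<close> move right.\<close>
      define h where "h = min b (min u m)"
      have "c < h" using \<open>c < b\<close> m JU Uc u by (auto simp: h_def)
      have "(g ^^ i) x \<in> U \<and> h \<le> (g ^^ i) x" if "x \<in> J" for i x
      proof (induction i)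
        case 0
        then show ?case using that m(2)[OF that] JU by (auto simp: h_def)
      next
        case (Suc i)
        let ?w = "(g ^^ i) x"
        show ?case
        proof (cases "?w \<ge> u")
          case True
          then have "b \<le> g ?w" using Suc closure_subset[of U] by (intro b(2)) (auto simp: L_def)
          then show ?thesis using Suc gU by (auto simp: h_def)
        next
          case False
          then have "g ?w > ?w" using Suc u by (intro up) auto
          then show ?thesis using Suc gU by auto
        qed
      qed
      then have "h \<le> x" if "x \<in> U" for x using that by (auto simp: U_def)
      then show ?thesis using cl[OF cL, of "h - c"] \<open>c < h\<close> by force
    qed
  qed
qed

text \<open>The interval \<open>U\<close> contains \<open>c\<close> or lies on one side of it. If it
  contains \<open>c\<close>, some point of \<open>J\<close> lands on the fixed point and stays
  there; the left side is turned into the right side by conjugation with the reflection at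
  0.\<close>

lemma iterates_approach_fixpoint:
  fixes g :: "real \<Rightarrow> real"
  assumes S: "compact S" "continuous_on S g" "g ` S \<subseteq> S"
    and J: "J \<subseteq> S" "compact J" "connected J" "J \<inter> g ` J \<noteq> {}"
    and c: "g c = c" "c \<in> closure (\<Union>i. (g ^^ i) ` J)"
    and "e > 0"
  shows "\<forall>\<^sub>F i in sequentially. \<exists>x\<in>J. \<bar>(g ^^ i) x - c\<bar> < e"
proof -
  define U where "U = (\<Union>i. (g ^^ i) ` J)"
  have conU: "connected U"
    unfolding U_def by (rule connected_UN_funpow_image[OF S(2,3) J(1,3,4)])
  consider "c \<in> U" | "\<And>x. x \<in> U \<Longrightarrow> c < x" | "\<And>x. x \<in> U \<Longrightarrow> x < c"
    using connectedD_interval[OF conU, of _ _ c] by (metis le_less_linear less_imp_le)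
  then show ?thesis
  proof cases
    case 1
    then obtain k y where y: "y \<in> J" "c = (g ^^ k) y" by (auto simp: U_def)
    have fix_c: "(g ^^ i) c = c" for i using c(1) by (induction i) auto
    have "\<exists>x\<in>J. \<bar>(g ^^ i) x - c\<bar> < e" if "i \<ge> k" for i
    proof (rule bexI[OF _ y(1)])
      have "(g ^^ i) y = (g ^^ (i - k)) c" using y that funpow_add[of "i - k" k g] by simp
      with fix_c \<open>e > 0\<close> show "\<bar>(g ^^ i) y - c\<bar> < e" by simp
    qed
    then show ?thesis by (auto simp: eventually_sequentially)
  next
    case 2
    then show ?thesis
      using iterates_approach_fixpoint_right[OF S J c _ \<open>e > 0\<close>] by (simp add: U_def)
  next
    case 3
    define h where "h x = - g (- x)" for x
    have hi: "(h ^^ i) x = - (g ^^ i) (- x)" for i x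
      by (induction i) (auto simp: h_def)
    have hU: "(\<Union>i. (h ^^ i) ` uminus ` J) = uminus ` U"
      by (simp add: hi image_image U_def image_UN)
    have "\<forall>\<^sub>F i in sequentially. \<exists>x\<in>uminus ` J. \<bar>(h ^^ i) x - (- c)\<bar> < e"
    proof (rule iterates_approach_fixpoint_right)
      show "compact (uminus ` S)" "compact (uminus ` J)"
        using S(1) J(2) by (auto intro: compact_negations)
      show "continuous_on (uminus ` S) h"
        unfolding h_def by (intro continuous_intros continuous_on_compose2[OF S(2)]) auto
      show "h ` uminus ` S \<subseteq> uminus ` S" using S(3) by (auto simp: h_def)
      show "uminus ` J \<subseteq> uminus ` S" using J(1) by auto
      show "connected (uminus ` J)" using J(3) by (intro connected_continuous_image continuous_intros)
      have "uminus ` J \<inter> h ` uminus ` J = uminus ` (J \<inter> g ` J)"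
        by (auto simp: h_def image_image)
      then show "uminus ` J \<inter> h ` uminus ` J \<noteq> {}" using J(4) by simp
      show "h (- c) = - c" using c(1) by (simp add: h_def)
      show "- c \<in> closure (\<Union>i. (h ^^ i) ` uminus ` J)"
        using imageI[OF c(2), of uminus] closure_injective_linear_image[of "uminus :: real \<Rightarrow> real" U]
        unfolding hU by (simp add: linear_uminus inj_def flip: U_def)
      show "- c < x" if "x \<in> (\<Union>i. (h ^^ i) ` uminus ` J)" for x
        using that 3 unfolding hU by auto
    qed fact
    then show ?thesis by (simp add: hi abs_minus_commute)
  qed
qed

section \<open>Nondegenerate intervals and simultaneous nested selection\<close>

definition nondegenerate :: "real set \<Rightarrow> bool" where
  "nondegenerate J \<longleftrightarrow> (\<exists>a b. 0 \<le> a \<and> a < b \<and> b \<le> 1 \<and> J = {a..b})"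

lemma nondegenerateD:
  assumes "nondegenerate J"
  shows "J \<subseteq> {0..1}" "J \<noteq> {}" "compact J" "connected J"
  using assms by (auto simp: nondegenerate_def)

text \<open>Cantor's nested interval argument for all indices at once: condition \<open>G t\<close>
  concerns the whole family and is secured at stage \<open>t\<close> by shrinking all intervals, so
  a family taken from the intersections satisfies every condition.\<close>

lemma nested_interval_selection:
  assumes J: "\<And>i. i \<in> I \<Longrightarrow> nondegenerate (J i)"
    and refine: "\<And>t K. (\<And>i. i \<in> I \<Longrightarrow> nondegenerate (K i) \<and> K i \<subseteq> J i) \<Longrightarrow>
      \<exists>K'. (\<forall>i\<in>I. nondegenerate (K' i) \<and> K' i \<subseteq> K i) \<and> (\<forall>x. (\<forall>i\<in>I. x i \<in> K' i) \<longrightarrow> G t x)"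
  shows "\<exists>x. (\<forall>i\<in>I. x i \<in> J i) \<and> (\<forall>t::nat. G t x)"
proof -
  have "\<exists>K. \<forall>n. (\<forall>i\<in>I. nondegenerate (K n i) \<and> K n i \<subseteq> J i) \<and>
    ((\<forall>i\<in>I. K (Suc n) i \<subseteq> K n i) \<and> (\<forall>x. (\<forall>i\<in>I. x i \<in> K (Suc n) i) \<longrightarrow> G n x))"
  proof (rule dependent_nat_choice)
    show "\<exists>K. \<forall>i\<in>I. nondegenerate (K i) \<and> K i \<subseteq> J i" using J by blast
    fix K n assume K: "\<forall>i\<in>I. nondegenerate (K i) \<and> K i \<subseteq> J i"
    then obtain K' where "\<forall>i\<in>I. nondegenerate (K' i) \<and> K' i \<subseteq> K i"
      "\<forall>x. (\<forall>i\<in>I. x i \<in> K' i) \<longrightarrow> G n x" using refine[of K n] by blast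
    with K show "\<exists>K'. (\<forall>i\<in>I. nondegenerate (K' i) \<and> K' i \<subseteq> J i) \<and>
      (\<forall>i\<in>I. K' i \<subseteq> K i) \<and> (\<forall>x. (\<forall>i\<in>I. x i \<in> K' i) \<longrightarrow> G n x)" by blast
  qed
  then obtain K where K: "\<And>n i. i \<in> I \<Longrightarrow> nondegenerate (K n i) \<and> K n i \<subseteq> J i"
    "\<And>n i. i \<in> I \<Longrightarrow> K (Suc n) i \<subseteq> K n i"
    "\<And>n x. (\<forall>i\<in>I. x i \<in> K (Suc n) i) \<Longrightarrow> G n x" by blast
  have "\<exists>y. \<forall>n. y \<in> K n i" if i: "i \<in> I" for i
  proof -
    have "\<Inter> (range (\<lambda>n. K n i)) \<noteq> {}"
    proof (rule compact_nest)
      show "compact (K n i)" "K n i \<noteq> {}" for n using K(1)[OF i] nondegenerateD by blast+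
      show "K n i \<subseteq> K m i" if "m \<le> n" for m n
        by (rule lift_Suc_antimono_le[OF _ that]) (rule K(2)[OF i])
    qed
    then show ?thesis by auto
  qed
  then obtain x where "\<forall>i\<in>I. \<forall>n. x i \<in> K n i" by metis
  with K show ?thesis by (intro exI[of _ x]) blast
qed

text \<open>Substitute for the Hausdorff metric without suprema and infima: on the hyperspace it
  implies distance at most \<open>e\<close> and follows from distance less than
  \<open>e\<close>.\<close>

definition hausdorff_close :: "real \<Rightarrow> real set \<Rightarrow> real set \<Rightarrow> bool" where
  "hausdorff_close e A B \<longleftrightarrow>
     (\<forall>x\<in>A. \<exists>y\<in>B. \<bar>x - y\<bar> < e) \<and> (\<forall>y\<in>B. \<exists>x\<in>A. \<bar>x - y\<bar> < e)"

lemma hausdorff_close_commute: "hausdorff_close e A B \<longleftrightarrow> hausdorff_close e B A"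
  by (auto simp: hausdorff_close_def abs_minus_commute)

text \<open>Dense chaos in the form used below: closed nondegenerate intervals replace open sets,
  and the limits in the definition of a Li-Yorke pair become statements about infinitely many
  times.\<close>

locale dense_chaos_interval =
  fixes f :: "real \<Rightarrow> real"
  assumes cont: "continuous_on {0..1} f"
    and maps: "f ` {0..1} \<subseteq> {0..1}"
    and dense: "\<And>J J'. nondegenerate J \<Longrightarrow> nondegenerate J' \<Longrightarrow>
      \<exists>u\<in>J. \<exists>v\<in>J'. (\<forall>e>0. \<exists>\<^sub>F n in sequentially. \<bar>(f ^^ n) u - (f ^^ n) v\<bar> < e) \<and>
        (\<exists>e>0. \<exists>\<^sub>F n in sequentially. e < \<bar>(f ^^ n) u - (f ^^ n) v\<bar>)"
begin

section \<open>Images of intervals under a densely chaotic map\<close>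

lemmas cont_funpow = continuous_on_funpow_self[OF cont maps]
lemmas maps_funpow = funpow_image_subset[OF maps]

lemma funpow_in: "x \<in> {0..1} \<Longrightarrow> (f ^^ n) x \<in> {0..1}"
  using maps_funpow by blast

text \<open>If \<open>f\<close> were constant on \<open>J\<close>, the iterates of any two points of
  \<open>J\<close> would agree from time 1 on; but \<open>J\<close> contains both members of a
  Li-Yorke pair.\<close>

lemma nondegenerate_image:
  assumes "nondegenerate J"
  shows "nondegenerate (f ` J)"
proof -
  obtain a b where ab: "0 \<le> a" "a < b" "b \<le> 1" "J = {a..b}"
    using assms by (auto simp: nondegenerate_def)
  then have "continuous_on {a..b} f" by (intro continuous_on_subset[OF cont]) auto
  then obtain c d where cd: "f ` J = {c..d}" "c \<le> d"
    using continuous_image_closed_interval[of a b f] ab by auto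
  obtain u v e where uv: "u \<in> J" "v \<in> J" "e > 0"
    "\<exists>\<^sub>F n in sequentially. e < \<bar>(f ^^ n) u - (f ^^ n) v\<bar>"
    using dense[OF assms assms] by blast
  have "c \<noteq> d"
  proof
    assume "c = d"
    then have "f u = f v" using cd uv(1,2) by (metis atLeastAtMost_singleton imageI singletonD)
    then have eq: "(f ^^ Suc n) u = (f ^^ Suc n) v" for n by (simp add: funpow_swap1)
    obtain n where "n \<ge> 1" "e < \<bar>(f ^^ n) u - (f ^^ n) v\<bar>"
      using uv(4) by (auto simp: frequently_sequentially)
    then show False using eq[of "n - 1"] \<open>e > 0\<close> by simp
  qed
  moreover have "{c..d} \<subseteq> {0..1}" using cd maps nondegenerateD(1)[OF assms] by blast
  ultimately show ?thesis using cd unfolding nondegenerate_def by auto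
qed

lemma nondegenerate_funpow_image: "nondegenerate J \<Longrightarrow> nondegenerate ((f ^^ n) ` J)"
proof (induction n)
  case (Suc n)
  then have "nondegenerate (f ` (f ^^ n) ` J)" by (intro nondegenerate_image)
  then show ?case by (simp add: image_comp)
qed simp

text \<open>Images of length more than \<open>e\<close> contain a multiple of \<open>e\<close>, and there are only finitely
  many of these in the unit interval.\<close>

lemma image_returns:
  assumes J: "nondegenerate J"
  shows "\<exists>n k. k \<ge> 1 \<and> (f ^^ n) ` J \<inter> (f ^^ (n + k)) ` J \<noteq> {}"
proof -
  obtain u v e where uv: "u \<in> J" "v \<in> J" "e > 0"
    "\<exists>\<^sub>F n in sequentially. e < \<bar>(f ^^ n) u - (f ^^ n) v\<bar>"
    using dense[OF J J] by blast
  define A where "A = {n. e < \<bar>(f ^^ n) u - (f ^^ n) v\<bar>}"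
  \<comment> \<open>\<open>h n\<close> numbers the first multiple of \<open>e\<close> at or above
    the lower of the two iterates; by the pigeonhole principle it takes one value at infinitely many
    times of \<open>A\<close>.\<close>
  define h where "h n = \<lceil>min ((f ^^ n) u) ((f ^^ n) v) / e\<rceil>" for n
  have "infinite A"
    using uv(4) by (simp add: A_def flip: cofinite_eq_sequentially frequently_cofinite)
  have in01: "(f ^^ n) u \<in> {0..1}" "(f ^^ n) v \<in> {0..1}" for n
    using uv nondegenerateD(1)[OF J] funpow_in by blast+
  have "h n \<in> {0..\<lceil>1 / e\<rceil>}" for n
  proof -
    let ?m = "min ((f ^^ n) u) ((f ^^ n) v)"
    have "0 \<le> ?m" "?m \<le> 1" using in01[of n] by auto
    then have "0 \<le> ?m / e" "?m / e \<le> 1 / e" using \<open>e > 0\<close> by (auto intro: divide_right_mono)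
    then show ?thesis unfolding h_def by (simp add: ceiling_mono order_less_le_trans[of "-1" 0])
  qed
  then have "finite (h ` A)" by (intro finite_subset[of "h ` A" "{0..\<lceil>1 / e\<rceil>}"]) auto
  then obtain n where n: "n \<in> A" "infinite {m \<in> A. h m = h n}"
    using pigeonhole_infinite[OF \<open>infinite A\<close>] by blast
  then obtain m where m: "m > n" "m \<in> A" "h m = h n"
    unfolding infinite_nat_iff_unbounded by blast
  have "of_int (h m) * e \<in> (f ^^ m) ` J" if "m \<in> A" for m
  proof -
    let ?lo = "min ((f ^^ m) u) ((f ^^ m) v)" and ?hi = "max ((f ^^ m) u) ((f ^^ m) v)"
    have "?lo / e \<le> of_int (h m)" "of_int (h m) < ?lo / e + 1"
      unfolding h_def by linarith+
    then have "?lo \<le> of_int (h m) * e" "of_int (h m) * e < ?lo + e"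
      using \<open>e > 0\<close> by (simp_all add: field_simps)
    moreover have "?lo + e < ?hi" using that by (auto simp: A_def)
    moreover have "connected ((f ^^ m) ` J)"
      using nondegenerateD(4)[OF nondegenerate_funpow_image[OF J]] .
    moreover have "?lo \<in> (f ^^ m) ` J" "?hi \<in> (f ^^ m) ` J"
      using uv by (auto simp: min_def max_def)
    ultimately show ?thesis
      using connectedD_interval[of "(f ^^ m) ` J" ?lo ?hi "of_int (h m) * e"] by linarith
  qed
  from this[OF n(1)] this[OF m(2)] m(3)
  have "(f ^^ n) ` J \<inter> (f ^^ m) ` J \<noteq> {}" by auto
  then show ?thesis using m(1) by (intro exI[of _ n] exI[of _ "m - n"]) auto
qed

section \<open>Periodic intervals and the fixed point that they share\<close>

definition periodic_intervals :: "real set set" where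
  "periodic_intervals = {L. nondegenerate L \<and> (\<exists>k\<ge>1. (f ^^ k) ` L \<subseteq> L)}"

text \<open>The overlap of \<open>J\<close> with its image under \<open>f ^^ k\<close> makes the
  union of the sampled orbit connected, so its closure is a compact interval; forward invariance
  passes to the closure by continuity.\<close>

lemma orbit_closure_periodic:
  assumes J: "nondegenerate J" and "k \<ge> 1" and meets: "J \<inter> (f ^^ k) ` J \<noteq> {}"
  shows "closure (\<Union>i. ((f ^^ k) ^^ i) ` J) \<in> periodic_intervals"
proof -
  define U where "U = (\<Union>i. ((f ^^ k) ^^ i) ` J)"
  have J01: "J \<subseteq> {0..1}" and "connected J" using J nondegenerateD by blast+
  have "connected U" unfolding U_def
    by (rule connected_UN_funpow_image[OF cont_funpow maps_funpow J01 \<open>connected J\<close> meets])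
  have "((f ^^ k) ^^ i) ` J \<subseteq> {0..1}" for i
    using J01 funpow_in by (auto simp: funpow_mult)
  then have U01: "U \<subseteq> {0..1}" by (auto simp: U_def)
  then have L01: "closure U \<subseteq> {0..1}" by (simp add: closure_minimal)
  then have "compact (closure U)"
    by (meson bounded_closed_interval bounded_subset closed_closure compact_eq_bounded_closed)
  then obtain a b where ab: "closure U = {a..b}"
    using \<open>connected U\<close> connected_imp_connected_closure connected_compact_interval_1 by metis
  have "J \<subseteq> U" unfolding U_def by (force intro: exI[of _ 0])
  then have "J \<subseteq> {a..b}" using ab closure_subset by blast
  then have "a < b" using J by (force simp: nondegenerate_def)
  with ab L01 have "nondegenerate (closure U)" unfolding nondegenerate_def by auto
  moreover have "(f ^^ k) ` closure U \<subseteq> closure U"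
  proof (rule image_closure_subset)
    show "continuous_on (closure U) (f ^^ k)" using cont_funpow L01 by (rule continuous_on_subset)
    have "(f ^^ k) ` U \<subseteq> U"
    proof
      fix x assume "x \<in> (f ^^ k) ` U"
      then obtain i y where "y \<in> J" "x = ((f ^^ k) ^^ Suc i) y" by (auto simp: U_def)
      then show "x \<in> U" unfolding U_def by blast
    qed
    then show "(f ^^ k) ` U \<subseteq> closure U" using closure_subset by blast
  qed simp
  ultimately show ?thesis using \<open>k \<ge> 1\<close> by (auto simp: periodic_intervals_def U_def)
qed

lemma funpow_mult_image_subset:
  assumes "(f ^^ k) ` L \<subseteq> L"
  shows "(f ^^ (k * m)) ` L \<subseteq> L"
  using funpow_image_subset[OF assms, of m] by (simp add: funpow_mult)

text \<open>Images of disjoint periodic intervals at the same time stay disjoint: equal iterates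
  would remain equal until a common return to both intervals. Only the times below a common period
  have to be considered, hence there is a uniform positive distance, which excludes a Li-Yorke pair
  with one member in each interval.\<close>

lemma periodic_intervals_meet:
  assumes "L \<in> periodic_intervals" "L' \<in> periodic_intervals"
  shows "L \<inter> L' \<noteq> {}"
proof
  assume disj: "L \<inter> L' = {}"
  obtain k k' where k: "k \<ge> 1" "(f ^^ k) ` L \<subseteq> L" "k' \<ge> 1" "(f ^^ k') ` L' \<subseteq> L'"
    and L: "nondegenerate L" "nondegenerate L'"
    using assms by (auto simp: periodic_intervals_def)
  \<comment> \<open>A common multiple of the periods, so that both intervals return at the same
    times.\<close>
  define K where "K = k * k'"
  have "K \<ge> 1" using k by (simp add: K_def)
  have inv: "(f ^^ (K * m)) ` L \<subseteq> L" "(f ^^ (K * m)) ` L' \<subseteq> L'" for m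
    using funpow_mult_image_subset[OF k(2), of "k' * m"] funpow_mult_image_subset[OF k(4), of "k * m"]
    by (simp_all add: K_def mult_ac)
  have "\<exists>d>0. \<forall>x\<in>(f ^^ r) ` L. \<forall>y\<in>(f ^^ r) ` L'. d \<le> dist x y" if r: "r < K" for r
  proof (rule separate_compact_closed)
    show "compact ((f ^^ r) ` L)" "closed ((f ^^ r) ` L')"
      using L nondegenerate_funpow_image nondegenerateD(3) compact_imp_closed by blast+
    show "(f ^^ r) ` L \<inter> (f ^^ r) ` L' = {}"
    proof (rule ccontr)
      assume "(f ^^ r) ` L \<inter> (f ^^ r) ` L' \<noteq> {}"
      then obtain x y where xy: "x \<in> L" "y \<in> L'" "(f ^^ r) x = (f ^^ r) y" by auto
      have "(f ^^ K) x = (f ^^ K) y"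
        using xy(3) r funpow_add[of "K - r" r f] by simp
      moreover have "(f ^^ K) x \<in> L" "(f ^^ K) y \<in> L'" using inv[of 1] xy by auto
      ultimately show False using disj by auto
    qed
  qed
  then obtain d where d: "\<And>r. r < K \<Longrightarrow> d r > 0"
    "\<And>r x y. r < K \<Longrightarrow> x \<in> L \<Longrightarrow> y \<in> L' \<Longrightarrow> d r \<le> \<bar>(f ^^ r) x - (f ^^ r) y\<bar>"
    unfolding dist_real_def by (metis imageI)
  define e where "e = Min (d ` {..<K})"
  have "e > 0" using d(1) \<open>K \<ge> 1\<close> by (auto simp: e_def Min_gr_iff lessThan_empty_iff)
  have le: "e \<le> d r" if "r < K" for r using that by (auto simp: e_def)
  obtain u v where uv: "u \<in> L" "v \<in> L'"
    and near: "\<forall>e>0. \<exists>\<^sub>F n in sequentially. \<bar>(f ^^ n) u - (f ^^ n) v\<bar> < e"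
    using dense[OF L] by blast
  obtain n where n: "\<bar>(f ^^ n) u - (f ^^ n) v\<bar> < e"
    using near[rule_format, OF \<open>e > 0\<close>] by (auto simp: frequently_sequentially)
  \<comment> \<open>At time \<open>?q\<close> both points are back in their intervals; the remaining
    \<open>?r < K\<close> steps are covered by the uniform bound.\<close>
  let ?r = "n mod K" and ?q = "K * (n div K)"
  have r: "?r < K" using \<open>K \<ge> 1\<close> by simp
  have split: "(f ^^ n) x = (f ^^ ?r) ((f ^^ ?q) x)" for x
    using funpow_add[of ?r ?q f] by simp
  have "(f ^^ ?q) u \<in> L" "(f ^^ ?q) v \<in> L'" using inv uv by blast+
  from d(2)[OF r this] le[OF r] n show False by (simp add: split)
qed

text \<open>Pairwise intersecting compact intervals have a common point (Helly's theorem on the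
  line). Their intersection is a compact interval that \<open>f\<close> maps into itself, so it
  contains a fixed point.\<close>

lemma common_fixpoint: "\<exists>c\<in>{0..1}. f c = c \<and> (\<forall>L\<in>periodic_intervals. c \<in> L)"
proof -
  \<comment> \<open>The unit interval makes the family nonempty and bounds the endpoints, so that
    \<open>lo\<close> and \<open>hi\<close> are a genuine supremum and infimum.\<close>
  have top: "{0..1} \<in> periodic_intervals"
    using maps by (auto simp: periodic_intervals_def nondegenerate_def intro!: exI[of _ 1])
  have L: "nondegenerate L" if "L \<in> periodic_intervals" for L
    using that by (auto simp: periodic_intervals_def)
  have ivl: "L = {Inf L..Sup L}" and bds: "0 \<le> Inf L" "Sup L \<le> 1" if "L \<in> periodic_intervals" for L
    using L[OF that] by (auto simp: nondegenerate_def)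
  define lo where "lo = (SUP L\<in>periodic_intervals. Inf L)"
  define hi where "hi = (INF L\<in>periodic_intervals. Sup L)"
  have le: "Inf L \<le> Sup L'" if LL: "L \<in> periodic_intervals" "L' \<in> periodic_intervals" for L L'
  proof -
    obtain x where "x \<in> L" "x \<in> L'" using periodic_intervals_meet[OF LL] by blast
    then have "Inf L \<le> x" "x \<le> Sup L'" using ivl[OF LL(1)] ivl[OF LL(2)] by auto
    then show ?thesis by simp
  qed
  have bdd: "bdd_above (Inf ` periodic_intervals)" "bdd_below (Sup ` periodic_intervals)"
    using le[OF _ top] le[OF top] by (auto intro!: bdd_aboveI bdd_belowI)
  have "lo \<le> hi"
    unfolding lo_def hi_def using top le by (intro cSUP_least cINF_greatest) auto
  have C: "x \<in> {lo..hi} \<longleftrightarrow> (\<forall>L\<in>periodic_intervals. x \<in> L)" for x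
  proof -
    have "x \<in> {lo..hi} \<longleftrightarrow> (\<forall>L\<in>periodic_intervals. Inf L \<le> x \<and> x \<le> Sup L)"
      using top cSUP_le_iff[OF _ bdd(1), of x] le_cINF_iff[OF _ bdd(2), of x]
      by (auto simp: lo_def hi_def)
    also have "\<dots> \<longleftrightarrow> (\<forall>L\<in>periodic_intervals. x \<in> L)"
      using ivl by (metis atLeastAtMost_iff)
    finally show ?thesis .
  qed
  have C01: "{lo..hi} \<subseteq> {0..1}" using C top by blast
  have fC: "f x \<in> {lo..hi}" if x: "x \<in> {lo..hi}" for x
    unfolding C
  proof
    fix L assume "L \<in> periodic_intervals"
    then obtain k where k: "k \<ge> 1" "(f ^^ k) ` L \<subseteq> L" by (auto simp: periodic_intervals_def)
    \<comment> \<open>The image of \<open>L\<close> one step before its return is itself periodic,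
      so it contains \<open>x\<close>; one more step leads from it into \<open>L\<close>.\<close>
    let ?L = "(f ^^ (k - 1)) ` L"
    have "(f ^^ k) ` ?L = (f ^^ (k - 1)) ` (f ^^ k) ` L"
      by (simp add: image_comp add.commute flip: funpow_add)
    also have "\<dots> \<subseteq> ?L" using k(2) by blast
    finally have "?L \<in> periodic_intervals"
      using k(1) nondegenerate_funpow_image L[OF \<open>L \<in> periodic_intervals\<close>]
      by (auto simp: periodic_intervals_def)
    then have "x \<in> ?L" using x C by blast
    then obtain y where "y \<in> L" "x = (f ^^ (k - 1)) y" by blast
    moreover have "f ((f ^^ (k - 1)) y) = (f ^^ k) y" using k(1) by (cases k) auto
    ultimately show "f x \<in> L" using k(2) by auto
  qed
  have "\<exists>c\<in>{lo..hi}. f c = c"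
  proof (rule brouwer)
    show "continuous_on {lo..hi} f" using cont C01 by (rule continuous_on_subset)
    show "f \<in> {lo..hi} \<rightarrow> {lo..hi}" using fC by blast
  qed (use \<open>lo \<le> hi\<close> in auto)
  then show ?thesis using C C01 by blast
qed

definition center :: real where
  "center = (SOME c. c \<in> {0..1} \<and> f c = c \<and> (\<forall>L\<in>periodic_intervals. c \<in> L))"

lemma center: "center \<in> {0..1}" "f center = center"
  and center_in_periodic: "L \<in> periodic_intervals \<Longrightarrow> center \<in> L"
  using someI_ex[OF common_fixpoint[unfolded Bex_def]] by (auto simp: center_def)

lemma funpow_center: "(f ^^ n) center = center"
  using center(2) by (induction n) auto

text \<open>Finitely many iterates are continuous at \<open>center\<close>, which they all fix. This
  bridges the gaps between times sampled at period \<open>k\<close>.\<close>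

lemma funpow_near_center:
  assumes "e > 0"
  shows "\<exists>d>0. \<forall>s<k. \<forall>x\<in>{0..1}. \<bar>x - center\<bar> < d \<longrightarrow> \<bar>(f ^^ s) x - center\<bar> < e"
proof -
  have "\<forall>\<^sub>F x in at center within {0..1}. \<forall>s\<in>{..<k}. \<bar>(f ^^ s) x - center\<bar> < e"
  proof (intro eventually_ball_finite ballI)
    fix s
    have "((f ^^ s) \<longlongrightarrow> (f ^^ s) center) (at center within {0..1})"
      using cont_funpow center(1) by (auto simp: continuous_on_def)
    then show "\<forall>\<^sub>F x in at center within {0..1}. \<bar>(f ^^ s) x - center\<bar> < e"
      using \<open>e > 0\<close> by (auto simp: tendsto_iff dist_real_def funpow_center)
  qed simp
  then obtain d where "d > 0" and d: "\<And>x s. x \<in> {0..1} \<Longrightarrow> x \<noteq> center \<Longrightarrow> \<bar>x - center\<bar> < d \<Longrightarrow>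
      s < k \<Longrightarrow> \<bar>(f ^^ s) x - center\<bar> < e"
    unfolding eventually_at dist_real_def by auto
  have "\<bar>(f ^^ s) x - center\<bar> < e" if "x \<in> {0..1}" "\<bar>x - center\<bar> < d" "s < k" for x s
    using d[of x s] that \<open>e > 0\<close> by (cases "x = center") (auto simp: funpow_center)
  with \<open>d > 0\<close> show ?thesis by blast
qed

text \<open>Some image \<open>J0\<close> of \<open>J\<close> meets its own image under
  \<open>f ^^ k\<close>, so the closure of its orbit under \<open>f ^^ k\<close> is a periodic
  interval and contains \<open>center\<close>. The approach result for the line covers the times
  sampled at period \<open>k\<close>, and continuity at \<open>center\<close> covers the
  others.\<close>

lemma images_approach_center:
  assumes J: "nondegenerate J" and "e > 0"
  shows "\<forall>\<^sub>F m in sequentially. \<exists>x\<in>J. \<bar>(f ^^ m) x - center\<bar> < e"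
proof -
  obtain n k where k: "k \<ge> 1" "(f ^^ n) ` J \<inter> (f ^^ (n + k)) ` J \<noteq> {}"
    using image_returns[OF J] by blast
  define J0 where "J0 = (f ^^ n) ` J"
  have J0: "nondegenerate J0" using nondegenerate_funpow_image[OF J] by (simp add: J0_def)
  have "(f ^^ k) ` J0 = (f ^^ (n + k)) ` J"
    by (simp add: J0_def image_comp add.commute flip: funpow_add)
  with k(2) have meets: "J0 \<inter> (f ^^ k) ` J0 \<noteq> {}" by (simp add: J0_def)
  obtain d where "d > 0" and d: "\<And>s x. s < k \<Longrightarrow> x \<in> {0..1} \<Longrightarrow> \<bar>x - center\<bar> < d \<Longrightarrow>
      \<bar>(f ^^ s) x - center\<bar> < e"
    using funpow_near_center[OF \<open>e > 0\<close>, of k] by blast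
  have "\<forall>\<^sub>F i in sequentially. \<exists>x\<in>J0. \<bar>((f ^^ k) ^^ i) x - center\<bar> < d"
    using iterates_approach_fixpoint[OF _ cont_funpow maps_funpow _ _ _ meets funpow_center
        center_in_periodic[OF orbit_closure_periodic[OF J0 k(1) meets]] \<open>d > 0\<close>]
      nondegenerateD[OF J0] by simp
  then obtain N where N: "\<And>i. i \<ge> N \<Longrightarrow> \<exists>x\<in>J0. \<bar>((f ^^ k) ^^ i) x - center\<bar> < d"
    by (auto simp: eventually_sequentially)
  have "\<exists>x\<in>J. \<bar>(f ^^ m) x - center\<bar> < e" if m: "m \<ge> n + k * N" for m
  proof -
    \<comment> \<open>After \<open>n\<close> initial steps, time is split into \<open>i\<close> full
      periods and a remainder \<open>s < k\<close>.\<close>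
    define i s where "i = (m - n) div k" and "s = (m - n) mod k"
    have "k * N \<le> m - n" using m by simp
    then have "i \<ge> N" using k(1) by (simp add: i_def less_eq_div_iff_mult_less_eq mult.commute)
    then obtain x where x: "x \<in> J" "\<bar>((f ^^ k) ^^ i) ((f ^^ n) x) - center\<bar> < d"
      using N by (auto simp: J0_def)
    have "m = s + (k * i + n)" using m by (simp add: i_def s_def)
    then have "(f ^^ m) x = (f ^^ s) (((f ^^ k) ^^ i) ((f ^^ n) x))"
      by (simp add: funpow_add funpow_mult)
    moreover have "((f ^^ k) ^^ i) ((f ^^ n) x) \<in> {0..1}"
      using x(1) nondegenerateD(1)[OF J] funpow_in by (auto simp: funpow_mult subset_iff)
    moreover have "s < k" using k(1) by (simp add: s_def)
    ultimately show ?thesis using x d by metis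
  qed
  then show ?thesis by (auto simp: eventually_sequentially)
qed

section \<open>Points asymptotic to the center and points escaping from it\<close>

lemma shrink_into_open:
  assumes J: "nondegenerate J" "x \<in> J" and W: "open W" "(f ^^ n) x \<in> W"
  shows "\<exists>K. nondegenerate K \<and> K \<subseteq> J \<and> (f ^^ n) ` K \<subseteq> W"
proof -
  obtain a b where ab: "0 \<le> a" "a < b" "b \<le> 1" "J = {a..b}"
    using J by (auto simp: nondegenerate_def)
  have "continuous_on J (f ^^ n)"
    using cont_funpow nondegenerateD(1)[OF J(1)] by (rule continuous_on_subset)
  then have "\<forall>\<^sub>F y in at x within J. (f ^^ n) y \<in> W"
    using J(2) W topological_tendstoD unfolding continuous_on_def by blast
  then obtain d where "d > 0" and d: "\<And>y. y \<in> J \<Longrightarrow> y \<noteq> x \<Longrightarrow> \<bar>y - x\<bar> < d \<Longrightarrow> (f ^^ n) y \<in> W"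
    unfolding eventually_at dist_real_def by auto
  \<comment> \<open>The half radius keeps the closed interval inside the
    \<open>d\<close>-neighbourhood of \<open>x\<close>; clipping at \<open>a\<close> and
    \<open>b\<close> also covers the case that \<open>x\<close> is an endpoint of
    \<open>J\<close>.\<close>
  define K where "K = {max a (x - d / 2)..min b (x + d / 2)}"
  have "max a (x - d / 2) < min b (x + d / 2)" using ab J(2) \<open>d > 0\<close> by auto
  then have "nondegenerate K" unfolding nondegenerate_def K_def using ab
    by (intro exI[of _ "max a (x - d / 2)"] exI[of _ "min b (x + d / 2)"]) auto
  moreover have "K \<subseteq> J" by (auto simp: K_def ab)
  moreover have "(f ^^ n) y \<in> W" if "y \<in> K" for y
  proof (cases "y = x")
    case False
    have "\<bar>y - x\<bar> < d" using that \<open>d > 0\<close> by (auto simp: K_def)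
    then show ?thesis using False that \<open>K \<subseteq> J\<close> d by blast
  qed (use W in simp)
  ultimately show ?thesis by blast
qed

lemma shrink_family_into_open:
  assumes "\<And>i. i \<in> I \<Longrightarrow> nondegenerate (J i)"
    and "\<And>i. i \<in> I \<Longrightarrow> open (W i) \<and> (\<exists>x\<in>J i. (f ^^ n) x \<in> W i)"
  shows "\<exists>K. \<forall>i\<in>I. nondegenerate (K i) \<and> K i \<subseteq> J i \<and> (f ^^ n) ` K i \<subseteq> W i"
  using assms shrink_into_open by (intro bchoice) blast

text \<open>Otherwise every subinterval of \<open>J\<close> has, for every \<open>d > 0\<close>, a
  further subinterval whose iterates are eventually within \<open>d\<close> of \<open>center\<close>
  as a whole. Nesting such intervals for \<open>d\<close> tending to 0 produces a point asymptotic
  to \<open>center\<close>, contrary to \<open>none\<close>.\<close>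

lemma no_asymptotic_point:
  assumes J: "nondegenerate J" and none: "\<And>x. x \<in> J \<Longrightarrow> \<not> (\<lambda>n. (f ^^ n) x) \<longlonglongrightarrow> center"
  shows "\<exists>K d. nondegenerate K \<and> K \<subseteq> J \<and> d > 0 \<and>
    (\<forall>K'. nondegenerate K' \<and> K' \<subseteq> K \<longrightarrow>
      (\<exists>\<^sub>F n in sequentially. \<exists>x\<in>K'. d \<le> \<bar>(f ^^ n) x - center\<bar>))"
proof (rule ccontr)
  assume *: "\<not> ?thesis"
  have shrink: "\<exists>K'. nondegenerate K' \<and> K' \<subseteq> K \<and> (\<forall>\<^sub>F n in sequentially. \<forall>x\<in>K'. \<bar>(f ^^ n) x - center\<bar> < d)"
    if "nondegenerate K" "K \<subseteq> J" "d > 0" for K d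
    using * that unfolding not_frequently not_ex not_all not_imp de_Morgan_conj bex_simps not_le by blast
  \<comment> \<open>Only one point is sought, so the index set is the unit type.\<close>
  have "\<exists>x. (\<forall>i\<in>{()}. x i \<in> J) \<and>
    (\<forall>t. \<forall>\<^sub>F n in sequentially. \<bar>(f ^^ n) (x ()) - center\<bar> < inverse (real (Suc t)))"
  proof (rule nested_interval_selection)
    fix t and K :: "unit \<Rightarrow> real set"
    assume "\<And>i. i \<in> {()} \<Longrightarrow> nondegenerate (K i) \<and> K i \<subseteq> J"
    then obtain K' where K': "nondegenerate K'" "K' \<subseteq> K ()"
      "\<forall>\<^sub>F n in sequentially. \<forall>x\<in>K'. \<bar>(f ^^ n) x - center\<bar> < inverse (real (Suc t))"
      using shrink[of "K ()" "inverse (real (Suc t))"] by auto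
    then show "\<exists>K'. (\<forall>i\<in>{()}. nondegenerate (K' i) \<and> K' i \<subseteq> K i) \<and>
      (\<forall>x. (\<forall>i\<in>{()}. x i \<in> K' i) \<longrightarrow>
        (\<forall>\<^sub>F n in sequentially. \<bar>(f ^^ n) (x ()) - center\<bar> < inverse (real (Suc t))))"
      by (intro exI[of _ "\<lambda>_. K'"]) (auto elim: eventually_mono)
  qed (rule J)
  then obtain x where x: "x \<in> J"
    "\<And>t. \<forall>\<^sub>F n in sequentially. \<bar>(f ^^ n) x - center\<bar> < inverse (real (Suc t))" by auto
  have "(\<lambda>n. (f ^^ n) x) \<longlonglongrightarrow> center"
  proof (rule tendstoI)
    fix e :: real assume "e > 0"
    then obtain t where "inverse (real (Suc t)) < e" using reals_Archimedean by blast
    with x(2)[of t] show "\<forall>\<^sub>F n in sequentially. dist ((f ^^ n) x) center < e"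
      by (auto simp: dist_real_def elim: eventually_mono)
  qed
  with none x(1) show False by blast
qed

text \<open>Each stage shrinks all intervals twice: to bring every point near \<open>center\<close>
  at a time \<open>n1\<close>, and then to send only the point of index \<open>j\<close> far away at
  a time \<open>n2\<close>. Every nondegenerate interval has points near \<open>center\<close> at
  all late times, so only the escape of index \<open>j\<close> restricts the times.\<close>

lemma select_escaping_point:
  assumes I: "finite I" "j \<in> I" "\<And>i. i \<in> I \<Longrightarrow> nondegenerate (J i)"
    and none: "\<And>x. x \<in> J j \<Longrightarrow> \<not> (\<lambda>n. (f ^^ n) x) \<longlonglongrightarrow> center"
  shows "\<exists>x. (\<forall>i\<in>I. x i \<in> J i) \<and>
    (\<forall>e>0. \<exists>\<^sub>F n in sequentially. \<forall>i\<in>I. \<bar>(f ^^ n) (x i) - center\<bar> < e) \<and>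
    (\<exists>d>0. \<exists>\<^sub>F n in sequentially. 2 * d < \<bar>(f ^^ n) (x j) - center\<bar> \<and>
      (\<forall>i\<in>I - {j}. \<bar>(f ^^ n) (x i) - center\<bar> < d))"
proof -
  obtain K0 r where K0: "nondegenerate K0" "K0 \<subseteq> J j" "r > 0"
    and far: "\<And>K'. nondegenerate K' \<Longrightarrow> K' \<subseteq> K0 \<Longrightarrow>
      \<exists>\<^sub>F n in sequentially. \<exists>x\<in>K'. r \<le> \<bar>(f ^^ n) x - center\<bar>"
    using no_asymptotic_point[OF I(3)[OF I(2)] none] by blast
  \<comment> \<open>With \<open>4 * d = r\<close>, points at distance at least \<open>r\<close> from
    \<open>center\<close> satisfy the open condition of lying more than \<open>2 * d\<close>
    away.\<close>
  define d where "d = r / 4"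
  have "d > 0" using \<open>r > 0\<close> by (simp add: d_def)
  have near: "\<forall>\<^sub>F m in sequentially. \<forall>i\<in>I. \<exists>x\<in>K i. \<bar>(f ^^ m) x - center\<bar> < e"
    if "\<And>i. i \<in> I \<Longrightarrow> nondegenerate (K i)" "e > 0" for K :: "'a \<Rightarrow> real set" and e
    using that I(1) images_approach_center by (intro eventually_ball_finite) auto
  \<comment> \<open>Starting in \<open>K0\<close> at index \<open>j\<close> keeps the later
    intervals of this index inside \<open>K0\<close>, so that escape stays available at every stage;
    \<open>n \<ge> t\<close> makes the times unbounded.\<close>
  have "\<exists>x. (\<forall>i\<in>I. x i \<in> (J(j := K0)) i) \<and>
    (\<forall>t. (\<exists>n\<ge>t. \<forall>i\<in>I. \<bar>(f ^^ n) (x i) - center\<bar> < inverse (real (Suc t))) \<and>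
      (\<exists>n\<ge>t. 2 * d < \<bar>(f ^^ n) (x j) - center\<bar> \<and> (\<forall>i\<in>I - {j}. \<bar>(f ^^ n) (x i) - center\<bar> < d)))"
  proof (rule nested_interval_selection)
    show "nondegenerate ((J(j := K0)) i)" if "i \<in> I" for i using that I K0 by auto
    fix t and K :: "'a \<Rightarrow> real set"
    assume K: "\<And>i. i \<in> I \<Longrightarrow> nondegenerate (K i) \<and> K i \<subseteq> (J(j := K0)) i"
    let ?e = "inverse (real (Suc t))"
    obtain n1 where n1: "n1 \<ge> t" "\<forall>i\<in>I. \<exists>x\<in>K i. \<bar>(f ^^ n1) x - center\<bar> < ?e"
      using eventually_conj[OF near[of K ?e] eventually_ge_at_top[of t]] K
      by (auto simp: eventually_sequentially)
    have "\<exists>K1. \<forall>i\<in>I. nondegenerate (K1 i) \<and> K1 i \<subseteq> K i \<and> (f ^^ n1) ` K1 i \<subseteq> ball center ?e"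
      using K n1 by (intro shrink_family_into_open) (auto simp: dist_real_def abs_minus_commute)
    then obtain K1 where K1: "\<And>i. i \<in> I \<Longrightarrow> nondegenerate (K1 i)" "\<And>i. i \<in> I \<Longrightarrow> K1 i \<subseteq> K i"
      "\<And>i. i \<in> I \<Longrightarrow> (f ^^ n1) ` K1 i \<subseteq> ball center ?e" by blast
    \<comment> \<open>Far points occur at infinitely many times only, but all intervals have points
      close to \<open>center\<close> at every late time, so both happen at some
      \<open>n2 \<ge> t\<close>.\<close>
    have "\<exists>\<^sub>F n in sequentially. \<exists>x\<in>K1 j. r \<le> \<bar>(f ^^ n) x - center\<bar>"
      using K1[OF I(2)] K[OF I(2)] by (intro far) auto
    moreover have "\<forall>\<^sub>F n in sequentially. (\<forall>i\<in>I. \<exists>x\<in>K1 i. \<bar>(f ^^ n) x - center\<bar> < d) \<and> t \<le> n"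
      using near[of K1 d] K1(1) \<open>d > 0\<close> by (intro eventually_conj eventually_ge_at_top) auto
    ultimately obtain n2 where n2: "n2 \<ge> t" "\<exists>x\<in>K1 j. r \<le> \<bar>(f ^^ n2) x - center\<bar>"
      "\<forall>i\<in>I. \<exists>x\<in>K1 i. \<bar>(f ^^ n2) x - center\<bar> < d"
      using frequently_ex[OF frequently_eventually_frequently] by blast
    define W where "W i = (if i = j then - cball center (2 * d) else ball center d)" for i
    have "2 * d < r" using \<open>r > 0\<close> by (simp add: d_def)
    have "\<exists>K2. \<forall>i\<in>I. nondegenerate (K2 i) \<and> K2 i \<subseteq> K1 i \<and> (f ^^ n2) ` K2 i \<subseteq> W i"
    proof (rule shrink_family_into_open)
      show "open (W i) \<and> (\<exists>x\<in>K1 i. (f ^^ n2) x \<in> W i)" if "i \<in> I" for i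
        using n2(2,3) that \<open>2 * d < r\<close>
        by (cases "i = j") (force simp: W_def dist_real_def abs_minus_commute)+
    qed (rule K1(1))
    then obtain K2 where K2: "\<And>i. i \<in> I \<Longrightarrow> nondegenerate (K2 i)" "\<And>i. i \<in> I \<Longrightarrow> K2 i \<subseteq> K1 i"
      "\<And>i. i \<in> I \<Longrightarrow> (f ^^ n2) ` K2 i \<subseteq> W i" by blast
    show "\<exists>K'. (\<forall>i\<in>I. nondegenerate (K' i) \<and> K' i \<subseteq> K i) \<and> (\<forall>x. (\<forall>i\<in>I. x i \<in> K' i) \<longrightarrow>
      (\<exists>n\<ge>t. \<forall>i\<in>I. \<bar>(f ^^ n) (x i) - center\<bar> < ?e) \<and>
      (\<exists>n\<ge>t. 2 * d < \<bar>(f ^^ n) (x j) - center\<bar> \<and> (\<forall>i\<in>I - {j}. \<bar>(f ^^ n) (x i) - center\<bar> < d)))"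
    proof (intro exI[of _ K2] conjI allI impI ballI)
      fix x assume x: "\<forall>i\<in>I. x i \<in> K2 i"
      have "(f ^^ n1) (x i) \<in> ball center ?e" "(f ^^ n2) (x i) \<in> W i" if "i \<in> I" for i
        using x that K1(3)[OF that] K2(2,3)[OF that] by blast+
      note * = this
      show "\<exists>n\<ge>t. \<forall>i\<in>I. \<bar>(f ^^ n) (x i) - center\<bar> < ?e"
        using n1(1) *(1) by (intro exI[of _ n1]) (auto simp: dist_real_def abs_minus_commute)
      have "2 * d < \<bar>(f ^^ n2) (x j) - center\<bar>"
        using *(2)[OF I(2)] by (simp add: W_def dist_real_def abs_minus_commute)
      moreover have "\<bar>(f ^^ n2) (x i) - center\<bar> < d" if "i \<in> I - {j}" for i
        using *(2)[of i] that by (simp add: W_def dist_real_def abs_minus_commute)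
      ultimately show "\<exists>n\<ge>t. 2 * d < \<bar>(f ^^ n) (x j) - center\<bar> \<and>
          (\<forall>i\<in>I - {j}. \<bar>(f ^^ n) (x i) - center\<bar> < d)"
        using n2(1) by blast
    qed (use K1 K2 in blast)+
  qed
  then obtain x where x: "\<forall>i\<in>I. x i \<in> (J(j := K0)) i"
    and close: "\<And>t. \<exists>n\<ge>t. \<forall>i\<in>I. \<bar>(f ^^ n) (x i) - center\<bar> < inverse (real (Suc t))"
    and apart: "\<And>t. \<exists>n\<ge>t. 2 * d < \<bar>(f ^^ n) (x j) - center\<bar> \<and>
      (\<forall>i\<in>I - {j}. \<bar>(f ^^ n) (x i) - center\<bar> < d)" by blast
  have "\<forall>i\<in>I. x i \<in> J i" using x K0(2) by (auto split: if_splits)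
  moreover have "\<exists>\<^sub>F n in sequentially. \<forall>i\<in>I. \<bar>(f ^^ n) (x i) - center\<bar> < e" if "e > 0" for e
    unfolding frequently_sequentially
  proof
    fix N
    \<comment> \<open>Stage \<open>max s N\<close> serves both the tolerance \<open>e\<close> and
      the lower bound \<open>N\<close> on the time.\<close>
    obtain s where "inverse (real (Suc s)) < e" using reals_Archimedean[OF \<open>e > 0\<close>] by blast
    moreover have "inverse (real (Suc (max s N))) \<le> inverse (real (Suc s))" by simp
    ultimately show "\<exists>n\<ge>N. \<forall>i\<in>I. \<bar>(f ^^ n) (x i) - center\<bar> < e"
      using close[of "max s N"] by (meson le_less_trans less_trans max.bounded_iff)
  qed
  moreover have "\<exists>\<^sub>F n in sequentially. 2 * d < \<bar>(f ^^ n) (x j) - center\<bar> \<and>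
      (\<forall>i\<in>I - {j}. \<bar>(f ^^ n) (x i) - center\<bar> < d)"
    unfolding frequently_sequentially using apart by blast
  ultimately show ?thesis using \<open>d > 0\<close> by blast
qed

section \<open>Li-Yorke pairs of finite sets and approximation by finite sets\<close>

definition li_yorke_sets :: "real set \<Rightarrow> real set \<Rightarrow> bool" where
  "li_yorke_sets A B \<longleftrightarrow>
     (\<forall>e>0. \<exists>\<^sub>F n in sequentially. hausdorff_close e ((f ^^ n) ` A) ((f ^^ n) ` B)) \<and>
     (\<exists>e>0. \<exists>\<^sub>F n in sequentially. \<not> hausdorff_close e ((f ^^ n) ` A) ((f ^^ n) ` B))"

lemma li_yorke_sets_commute: "li_yorke_sets A B \<longleftrightarrow> li_yorke_sets B A"
  by (simp add: li_yorke_sets_def hausdorff_close_commute)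

text \<open>When all selected points are near \<open>center\<close>, the two sets are near each
  other; when \<open>p a\<close> is the only one far from \<open>center\<close>, no point of the
  other set is near it.\<close>

lemma li_yorke_sets_escaping:
  assumes fin: "finite A" "finite B" "B \<noteq> {}" and "a \<in> A"
    and J: "\<And>x. x \<in> A \<union> B \<Longrightarrow> nondegenerate (J x)"
    and none: "\<And>x. x \<in> J a \<Longrightarrow> \<not> (\<lambda>n. (f ^^ n) x) \<longlonglongrightarrow> center"
  shows "\<exists>p q. (\<forall>x\<in>A. p x \<in> J x) \<and> (\<forall>x\<in>B. q x \<in> J x) \<and> li_yorke_sets (p ` A) (q ` B)"
proof -
  \<comment> \<open>The disjoint sum allows for indices common to \<open>A\<close> and
    \<open>B\<close>, for which two points are selected in the same interval.\<close>
  let ?I = "A <+> B"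
  obtain x d where x: "\<forall>i\<in>?I. x i \<in> case_sum J J i"
    and close: "\<And>e. e > 0 \<Longrightarrow> \<exists>\<^sub>F n in sequentially. \<forall>i\<in>?I. \<bar>(f ^^ n) (x i) - center\<bar> < e"
    and "d > 0" and apart: "\<exists>\<^sub>F n in sequentially. 2 * d < \<bar>(f ^^ n) (x (Inl a)) - center\<bar> \<and>
      (\<forall>i\<in>?I - {Inl a}. \<bar>(f ^^ n) (x i) - center\<bar> < d)"
    using select_escaping_point[of ?I "Inl a" "case_sum J J"] fin \<open>a \<in> A\<close> J none by fastforce
  define p q where "p = (\<lambda>y. x (Inl y))" and "q = (\<lambda>y. x (Inr y))"
  have "\<exists>\<^sub>F n in sequentially. hausdorff_close e ((f ^^ n) ` p ` A) ((f ^^ n) ` q ` B)" if "e > 0" for e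
  proof (rule frequently_elim1[OF close[of "e / 2"]])
    fix n assume n: "\<forall>i\<in>?I. \<bar>(f ^^ n) (x i) - center\<bar> < e / 2"
    have lt: "\<bar>(f ^^ n) (p y) - (f ^^ n) (q z)\<bar> < e" if "y \<in> A" "z \<in> B" for y z
      using bspec[OF n InlI[OF that(1)]] bspec[OF n InrI[OF that(2)]]
      unfolding p_def q_def by linarith
    then show "hausdorff_close e ((f ^^ n) ` p ` A) ((f ^^ n) ` q ` B)"
      using \<open>B \<noteq> {}\<close> \<open>a \<in> A\<close> unfolding hausdorff_close_def by blast
  qed (use \<open>e > 0\<close> in simp)
  moreover have "\<exists>\<^sub>F n in sequentially. \<not> hausdorff_close d ((f ^^ n) ` p ` A) ((f ^^ n) ` q ` B)"
  proof (rule frequently_elim1[OF apart])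
    fix n assume n: "2 * d < \<bar>(f ^^ n) (x (Inl a)) - center\<bar> \<and>
      (\<forall>i\<in>?I - {Inl a}. \<bar>(f ^^ n) (x i) - center\<bar> < d)"
    have "\<not> \<bar>(f ^^ n) (p a) - (f ^^ n) (q z)\<bar> < d" if "z \<in> B" for z
    proof -
      have "\<bar>(f ^^ n) (q z) - center\<bar> < d" using n that by (auto simp: q_def)
      moreover have "2 * d < \<bar>(f ^^ n) (p a) - center\<bar>" using n by (simp add: p_def)
      ultimately show ?thesis by linarith
    qed
    then show "\<not> hausdorff_close d ((f ^^ n) ` p ` A) ((f ^^ n) ` q ` B)"
      using \<open>a \<in> A\<close> unfolding hausdorff_close_def by blast
  qed
  ultimately have "li_yorke_sets (p ` A) (q ` B)" using \<open>d > 0\<close> by (auto simp: li_yorke_sets_def)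
  moreover have "\<forall>y\<in>A. p y \<in> J y" "\<forall>y\<in>B. q y \<in> J y"
    using x by (force simp: p_def q_def)+
  ultimately show ?thesis by blast
qed

text \<open>At late times the points of \<open>A\<close> and \<open>B\<close> are gathered at
  \<open>center\<close>. The sets are then close whenever the iterates of \<open>u\<close> and
  \<open>v\<close> are; and when these are far apart, one of them is far from \<open>center\<close>
  as well.\<close>

lemma li_yorke_sets_asymptotic:
  assumes fin: "finite A" "finite B" "A \<noteq> {}" "B \<noteq> {}"
    and lim: "\<And>x. x \<in> A \<union> B \<Longrightarrow> (\<lambda>n. (f ^^ n) x) \<longlonglongrightarrow> center"
    and near: "\<forall>e>0. \<exists>\<^sub>F n in sequentially. \<bar>(f ^^ n) u - (f ^^ n) v\<bar> < e"
    and far: "e > 0" "\<exists>\<^sub>F n in sequentially. e < \<bar>(f ^^ n) u - (f ^^ n) v\<bar>"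
  shows "li_yorke_sets (insert u A) (insert v B)"
proof -
  have lim': "\<forall>\<^sub>F n in sequentially. \<forall>x\<in>A \<union> B. \<bar>(f ^^ n) x - center\<bar> < r" if "r > 0" for r
    using fin lim that by (intro eventually_ball_finite) (auto simp: tendsto_iff dist_real_def)
  have "\<exists>\<^sub>F n in sequentially. hausdorff_close r ((f ^^ n) ` insert u A) ((f ^^ n) ` insert v B)"
    if "r > 0" for r
  proof (rule frequently_elim1)
    show "\<exists>\<^sub>F n in sequentially. \<bar>(f ^^ n) u - (f ^^ n) v\<bar> < r \<and>
        (\<forall>x\<in>A \<union> B. \<bar>(f ^^ n) x - center\<bar> < r / 2)"
      using \<open>r > 0\<close> near by (intro frequently_eventually_frequently lim') auto
    fix n assume n: "\<bar>(f ^^ n) u - (f ^^ n) v\<bar> < r \<and> (\<forall>x\<in>A \<union> B. \<bar>(f ^^ n) x - center\<bar> < r / 2)"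
    have "\<bar>(f ^^ n) y - (f ^^ n) z\<bar> < r" if "y \<in> A" "z \<in> B" for y z
    proof -
      have "\<bar>(f ^^ n) y - center\<bar> < r / 2" "\<bar>(f ^^ n) z - center\<bar> < r / 2" using n that by auto
      then show ?thesis by linarith
    qed
    with n show "hausdorff_close r ((f ^^ n) ` insert u A) ((f ^^ n) ` insert v B)"
      using fin(3,4) unfolding hausdorff_close_def by blast
  qed
  moreover have "\<exists>\<^sub>F n in sequentially. \<not> hausdorff_close (e / 4) ((f ^^ n) ` insert u A) ((f ^^ n) ` insert v B)"
  proof (rule frequently_elim1)
    show "\<exists>\<^sub>F n in sequentially. e < \<bar>(f ^^ n) u - (f ^^ n) v\<bar> \<and>
        (\<forall>x\<in>A \<union> B. \<bar>(f ^^ n) x - center\<bar> < e / 4)"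
      using far by (intro frequently_eventually_frequently lim') auto
    fix n assume n: "e < \<bar>(f ^^ n) u - (f ^^ n) v\<bar> \<and> (\<forall>x\<in>A \<union> B. \<bar>(f ^^ n) x - center\<bar> < e / 4)"
    then have uv: "e < \<bar>(f ^^ n) u - (f ^^ n) v\<bar>" by blast
    \<comment> \<open>By the triangle inequality one of the two iterates is more than
      \<open>e / 2\<close> away from \<open>center\<close>, hence more than \<open>e / 4\<close>
      away from all points within \<open>e / 4\<close> of \<open>center\<close>.\<close>
    then consider "e / 2 < \<bar>(f ^^ n) u - center\<bar>" | "e / 2 < \<bar>(f ^^ n) v - center\<bar>" by linarith
    then show "\<not> hausdorff_close (e / 4) ((f ^^ n) ` insert u A) ((f ^^ n) ` insert v B)"
    proof cases
      case 1
      have "\<not> \<bar>(f ^^ n) u - (f ^^ n) z\<bar> < e / 4" if "z \<in> insert v B" for z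
      proof (cases "z = v")
        case False
        then have "\<bar>(f ^^ n) z - center\<bar> < e / 4" using n that by auto
        with 1 show ?thesis by linarith
      qed (use uv far in auto)
      then show ?thesis unfolding hausdorff_close_def by blast
    next
      case 2
      have "\<not> \<bar>(f ^^ n) z - (f ^^ n) v\<bar> < e / 4" if "z \<in> insert u A" for z
      proof (cases "z = u")
        case False
        then have "\<bar>(f ^^ n) z - center\<bar> < e / 4" using n that by auto
        with 2 show ?thesis by linarith
      qed (use uv far in auto)
      then show ?thesis unfolding hausdorff_close_def by blast
    qed
  qed
  ultimately show ?thesis using far(1) unfolding li_yorke_sets_def
    by (meson divide_pos_pos zero_less_numeral)
qed

text \<open>Either every interval contains a point asymptotic to \<open>center\<close>, and a
  Li-Yorke pair is added to such points; or some interval contains none, and escape from it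
  separates the two sets. The relation is symmetric, so that interval may belong to either
  side.\<close>

lemma finite_li_yorke_sets:
  assumes fin: "finite A" "finite B" "A \<noteq> {}" "B \<noteq> {}"
    and J: "\<And>x. x \<in> A \<union> B \<Longrightarrow> nondegenerate (J x)"
  shows "\<exists>A' B'. finite A' \<and> finite B' \<and> A' \<noteq> {} \<and> B' \<noteq> {} \<and>
    A' \<subseteq> (\<Union>x\<in>A. J x) \<and> (\<forall>x\<in>A. A' \<inter> J x \<noteq> {}) \<and>
    B' \<subseteq> (\<Union>x\<in>B. J x) \<and> (\<forall>x\<in>B. B' \<inter> J x \<noteq> {}) \<and> li_yorke_sets A' B'"
proof (cases "\<forall>x\<in>A \<union> B. \<exists>y\<in>J x. (\<lambda>n. (f ^^ n) y) \<longlonglongrightarrow> center")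
  case True
  then obtain p where p: "\<And>x. x \<in> A \<union> B \<Longrightarrow> p x \<in> J x \<and> (\<lambda>n. (f ^^ n) (p x)) \<longlonglongrightarrow> center"
    by metis
  obtain a b where ab: "a \<in> A" "b \<in> B" using fin by blast
  \<comment> \<open>Taking \<open>u\<close> and \<open>v\<close> from the intervals of
    \<open>a\<close> and \<open>b\<close> keeps the enlarged sets inside the prescribed
    unions.\<close>
  obtain u v e where uv: "u \<in> J a" "v \<in> J b"
    "\<forall>e>0. \<exists>\<^sub>F n in sequentially. \<bar>(f ^^ n) u - (f ^^ n) v\<bar> < e"
    "e > 0" "\<exists>\<^sub>F n in sequentially. e < \<bar>(f ^^ n) u - (f ^^ n) v\<bar>"
    using dense[OF J J] ab by blast
  have "li_yorke_sets (insert u (p ` A)) (insert v (p ` B))"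
    using fin p by (intro li_yorke_sets_asymptotic[OF _ _ _ _ _ uv(3-5)]) auto
  with fin p ab uv(1,2) show ?thesis
    by (intro exI[of _ "insert u (p ` A)"] exI[of _ "insert v (p ` B)"]) auto
next
  case False
  then obtain c where c: "c \<in> A \<union> B" "\<And>y. y \<in> J c \<Longrightarrow> \<not> (\<lambda>n. (f ^^ n) y) \<longlonglongrightarrow> center" by blast
  have "\<exists>p q. (\<forall>x\<in>A. p x \<in> J x) \<and> (\<forall>x\<in>B. q x \<in> J x) \<and> li_yorke_sets (p ` A) (q ` B)"
  proof (cases "c \<in> A")
    case True
    then show ?thesis using fin J c by (intro li_yorke_sets_escaping) auto
  next
    case False
    then have "c \<in> B" using c by simp
    then have "\<exists>q p. (\<forall>x\<in>B. q x \<in> J x) \<and> (\<forall>x\<in>A. p x \<in> J x) \<and> li_yorke_sets (q ` B) (p ` A)"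
      using fin J c by (intro li_yorke_sets_escaping) auto
    then show ?thesis using li_yorke_sets_commute by blast
  qed
  then obtain p q where "\<forall>x\<in>A. p x \<in> J x" "\<forall>x\<in>B. q x \<in> J x" "li_yorke_sets (p ` A) (q ` B)"
    by blast
  with fin show ?thesis
    by (intro exI[of _ "p ` A"] exI[of _ "q ` B"]) auto
qed

end

text \<open>The net has mesh \<open>r / 2\<close> and the intervals around its points have radius
  \<open>r / 3\<close>. The sum \<open>5 / 6 * r\<close> stays strictly below \<open>r\<close>, so a
  nonstrict bound on the Hausdorff distance will suffice.\<close>

lemma hausdorff_close_finite_net:
  assumes net: "N \<subseteq> A" "A \<subseteq> (\<Union>x\<in>N. ball x (r / 2))" and "r > 0"
    and J: "\<And>x. x \<in> N \<Longrightarrow> J x \<subseteq> cball x (r / 3)"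
    and A': "A' \<subseteq> (\<Union>x\<in>N. J x)" "\<forall>x\<in>N. A' \<inter> J x \<noteq> {}"
  shows "hausdorff_close (5 / 6 * r) A A'"
  unfolding hausdorff_close_def
proof (intro conjI ballI)
  fix x assume "x \<in> A"
  then obtain y where y: "y \<in> N" "\<bar>y - x\<bar> < r / 2" using net(2) by (auto simp: dist_real_def)
  then obtain z where z: "z \<in> A'" "z \<in> J y" using A'(2) by blast
  then have "\<bar>y - z\<bar> \<le> r / 3" using J[OF y(1)] by (auto simp: dist_real_def)
  with y(2) have "\<bar>x - z\<bar> < 5 / 6 * r" by linarith
  with z show "\<exists>z\<in>A'. \<bar>x - z\<bar> < 5 / 6 * r" by blast
next
  fix z assume "z \<in> A'"
  then obtain y where y: "y \<in> N" "z \<in> J y" using A'(1) by blast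
  then have "\<bar>y - z\<bar> \<le> r / 3" using J[OF y(1)] by (auto simp: dist_real_def)
  with \<open>r > 0\<close> have "\<bar>y - z\<bar> < 5 / 6 * r" by linarith
  with y net(1) show "\<exists>y\<in>A. \<bar>y - z\<bar> < 5 / 6 * r" by blast
qed

section \<open>Dense chaos of the induced map\<close>

lemma funpow_image:
  fixes f :: "'a \<Rightarrow> 'a"
  shows "((\<lambda>K. f ` K) ^^ n) A = (f ^^ n) ` A"
  by (induction n) (auto simp: image_comp)

theorem theorem4p1:
  fixes f :: "real \<Rightarrow> real"
  assumes "continuous_on {0..1} f"
    and "f \<in> {0..1} \<rightarrow> {0..1}"
    and "Metric_space.densely_chaotic {0..1} dist f"
  shows "Metric_space.densely_chaotic
           (Metric_space.hyperspace {0..1::real} dist)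
           (Metric_space.hausdorff_dist {0..1::real} dist)
           (\<lambda>K. f ` K)"
proof -
  interpret X: Metric_space "{0..1::real}" dist
    by unfold_locales (auto simp: dist_commute dist_triangle)
  interpret H: Metric_space X.hyperspace X.hausdorff_dist
    by (rule X.Metric_space_hyperspace)
  have H: "X.hyperspace = {K. K \<noteq> {} \<and> compact K \<and> K \<subseteq> {0..1}}"
    by (rule hyperspace_dist_eq)
  have le: "X.hausdorff_dist A B \<le> e"
    if "hausdorff_close e A B" "A \<in> X.hyperspace" "B \<in> X.hyperspace" for e A B
    using that unfolding hausdorff_close_def
    by (intro X.hausdorff_dist_le) (simp_all add: dist_real_def, (meson less_imp_le)+)
  have close: "hausdorff_close e A B"
    if "X.hausdorff_dist A B < e" "A \<in> X.hyperspace" "B \<in> X.hyperspace" for e A B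
    using X.hausdorff_dist_less_imp[OF that(2,3,1)] by (simp add: hausdorff_close_def dist_real_def)
  interpret dense_chaos_interval f
  proof
    show "continuous_on {0..1} f" "f ` {0..1} \<subseteq> {0..1}" using assms by auto
    fix J J' assume "nondegenerate J" "nondegenerate J'"
    then obtain a b a' b' where J: "0 \<le> a" "a < b" "b \<le> 1" "J = {a..b}"
      "0 \<le> a'" "a' < b'" "b' \<le> 1" "J' = {a'..b'}"
      by (auto simp: nondegenerate_def)
    \<comment> \<open>At most half of each length, so that the balls around the midpoints lie in
      \<open>J\<close> and \<open>J'\<close>.\<close>
    define r where "r = min (b - a) (b' - a') / 2"
    have r: "r > 0" "2 * r \<le> b - a" "2 * r \<le> b' - a'" using J by (auto simp: r_def)
    obtain u v where uv: "(u, v) \<in> X.li_yorke_pairs f"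
      "dist ((a + b) / 2) u < r" "dist ((a' + b') / 2) v < r"
      using assms(3)[unfolded X.densely_chaotic_iff, rule_format, of "(a + b) / 2" "(a' + b') / 2" r]
        J r by auto
    have "u \<in> J" "v \<in> J'"
      using uv(2,3) r J unfolding dist_real_def abs_less_iff by (auto simp: field_simps)
    with uv(1) show "\<exists>u\<in>J. \<exists>v\<in>J'.
        (\<forall>e>0. \<exists>\<^sub>F n in sequentially. \<bar>(f ^^ n) u - (f ^^ n) v\<bar> < e) \<and>
        (\<exists>e>0. \<exists>\<^sub>F n in sequentially. e < \<bar>(f ^^ n) u - (f ^^ n) v\<bar>)"
      by (auto simp: X.li_yorke_pairs_iff dist_real_def)
  qed
  have finite_H: "(f ^^ n) ` A \<in> X.hyperspace" if "finite A" "A \<noteq> {}" "A \<subseteq> {0..1}" for A n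
    using that maps_funpow[of n] by (auto simp: H finite_imp_compact)
  \<comment> \<open>Finite nonempty sets stay such under iteration, hence remain in the hyperspace,
    where \<open>hausdorff_close\<close> and the metric can be exchanged.\<close>
  have pair: "(A, B) \<in> H.li_yorke_pairs (\<lambda>K. f ` K)"
    if AB: "finite A" "A \<noteq> {}" "A \<subseteq> {0..1}" "finite B" "B \<noteq> {}" "B \<subseteq> {0..1}"
      and LY: "li_yorke_sets A B" for A B
    unfolding H.li_yorke_pairs_iff funpow_image
  proof (intro conjI allI impI)
    show "A \<in> X.hyperspace" "B \<in> X.hyperspace"
      using finite_H[OF AB(1-3), of 0] finite_H[OF AB(4-6), of 0] by simp_all
    fix e :: real assume "e > 0"
    \<comment> \<open>Halving \<open>e\<close> restores strictness, since closeness gives only a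
      nonstrict bound on the distance.\<close>
    then have "\<exists>\<^sub>F n in sequentially. hausdorff_close (e / 2) ((f ^^ n) ` A) ((f ^^ n) ` B)"
      using LY by (auto simp: li_yorke_sets_def)
    then show "\<exists>\<^sub>F n in sequentially. X.hausdorff_dist ((f ^^ n) ` A) ((f ^^ n) ` B) < e"
    proof (rule frequently_elim1)
      fix n assume "hausdorff_close (e / 2) ((f ^^ n) ` A) ((f ^^ n) ` B)"
      from le[OF this finite_H[OF AB(1-3)] finite_H[OF AB(4-6)]] \<open>e > 0\<close>
      show "X.hausdorff_dist ((f ^^ n) ` A) ((f ^^ n) ` B) < e" by simp
    qed
  next
    obtain e where e: "e > 0"
      "\<exists>\<^sub>F n in sequentially. \<not> hausdorff_close e ((f ^^ n) ` A) ((f ^^ n) ` B)"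
      using LY by (auto simp: li_yorke_sets_def)
    have "\<exists>\<^sub>F n in sequentially. e / 2 < X.hausdorff_dist ((f ^^ n) ` A) ((f ^^ n) ` B)"
      using e(2)
    proof (rule frequently_elim1)
      fix n assume "\<not> hausdorff_close e ((f ^^ n) ` A) ((f ^^ n) ` B)"
      then have "\<not> X.hausdorff_dist ((f ^^ n) ` A) ((f ^^ n) ` B) < e"
        using close finite_H[OF AB(1-3)] finite_H[OF AB(4-6)] by blast
      then show "e / 2 < X.hausdorff_dist ((f ^^ n) ` A) ((f ^^ n) ` B)" using \<open>e > 0\<close> by simp
    qed
    then show "\<exists>e>0. \<exists>\<^sub>F n in sequentially. e < X.hausdorff_dist ((f ^^ n) ` A) ((f ^^ n) ` B)"
      using \<open>e > 0\<close> by (intro exI[of _ "e / 2"]) simp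
  qed
  have net: "\<exists>N. finite N \<and> N \<noteq> {} \<and> N \<subseteq> A \<and> A \<subseteq> (\<Union>x\<in>N. ball x r)"
    if "A \<in> X.hyperspace" "r > 0" for A and r :: real
  proof -
    have A: "compact A" "A \<noteq> {}" using that(1) by (auto simp: H)
    have cover: "A \<subseteq> (\<Union>x\<in>A. ball x r)" using \<open>r > 0\<close> by auto
    obtain N where N: "N \<subseteq> A" "finite N" "A \<subseteq> (\<Union>x\<in>N. ball x r)"
      by (rule compactE_image[OF A(1) open_ball cover])
    moreover have "N \<noteq> {}" using N(3) A(2) by auto
    ultimately show ?thesis by metis
  qed
  show ?thesis
    unfolding H.densely_chaotic_iff
  proof (intro ballI allI impI)
    fix A B and r :: real assume AB: "A \<in> X.hyperspace" "B \<in> X.hyperspace" and "r > 0"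
    obtain N where N: "finite N" "N \<noteq> {}" "N \<subseteq> A" "A \<subseteq> (\<Union>x\<in>N. ball x (r / 2))"
      using net[OF AB(1), of "r / 2"] \<open>r > 0\<close> by auto
    obtain P where P: "finite P" "P \<noteq> {}" "P \<subseteq> B" "B \<subseteq> (\<Union>x\<in>P. ball x (r / 2))"
      using net[OF AB(2), of "r / 2"] \<open>r > 0\<close> by auto
    \<comment> \<open>Clipping to the unit interval leaves positive length even around the endpoints
      0 and 1.\<close>
    define J where "J x = {max 0 (x - r / 3)..min 1 (x + r / 3)}" for x
    have J: "J x \<subseteq> cball x (r / 3)" for x by (auto simp: J_def dist_real_def abs_if)
    have "nondegenerate (J x)" if "x \<in> {0..1}" for x
      unfolding nondegenerate_def J_def using that \<open>r > 0\<close>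
      by (intro exI[of _ "max 0 (x - r / 3)"] exI[of _ "min 1 (x + r / 3)"]) auto
    then have "nondegenerate (J x)" if "x \<in> N \<union> P" for x
      using that N(3) P(3) AB by (auto simp: H)
    from finite_li_yorke_sets[where J = J, OF N(1) P(1) N(2) P(2) this]
    obtain A' B' where A'B': "finite A'" "finite B'" "A' \<noteq> {}" "B' \<noteq> {}"
      "A' \<subseteq> (\<Union>x\<in>N. J x)" "\<forall>x\<in>N. A' \<inter> J x \<noteq> {}"
      "B' \<subseteq> (\<Union>x\<in>P. J x)" "\<forall>x\<in>P. B' \<inter> J x \<noteq> {}" "li_yorke_sets A' B'" by blast
    have sub: "A' \<subseteq> {0..1}" "B' \<subseteq> {0..1}" using A'B'(5,7) by (force simp: J_def)+
    have H': "A' \<in> X.hyperspace" "B' \<in> X.hyperspace"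
      using finite_H[of A' 0] finite_H[of B' 0] A'B'(1-4) sub by simp_all
    have "X.hausdorff_dist A A' \<le> 5 / 6 * r" "X.hausdorff_dist B B' \<le> 5 / 6 * r"
      using le[OF hausdorff_close_finite_net[OF N(3,4) \<open>r > 0\<close> J A'B'(5,6)] AB(1) H'(1)]
        le[OF hausdorff_close_finite_net[OF P(3,4) \<open>r > 0\<close> J A'B'(7,8)] AB(2) H'(2)] .
    moreover have "(A', B') \<in> H.li_yorke_pairs (\<lambda>K. f ` K)"
      using A'B' sub by (intro pair) auto
    ultimately show "\<exists>u v. (u, v) \<in> H.li_yorke_pairs (\<lambda>K. f ` K) \<and>
        X.hausdorff_dist A u < r \<and> X.hausdorff_dist B v < r"
      using \<open>r > 0\<close> by (intro exI[of _ A'] exI[of _ B']) auto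
  qed
qed

end
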